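(* Let $V=(V,Y,\mathbf 1,\omega)$ be a vertex operator superalgebra and let $g$ be an automorphism of $V$ of finite order. Let $A_g(V)=V/O_g(V)$ and let $*_g$ be the bilinear product on $V$, both as defined in the context. Then: (i) $*_g$ induces a product on $A_g(V)$ under which $A_g(V)$ is an associative algebra. (ii) $\mathbf 1+O_g(V)$ is the unit of $A_g(V)$. (iii) $\omega+O_g(V)$ lies in the center of $A_g(V)$.
   Context: Vertex operator superalgebra: a $\frac12\mathbb Z_+$-graded complex vector space $V=\bigoplus_{n\in\frac12\mathbb Z_+}V_n$ ($\mathbb Z_+$ = nonnegative integers), $\dim V_n<\infty$, with even part $V_{\bar0}=\bigoplus_{n\in\mathbb Z}V_n$ and odd part $V_{\bar1}=\bigoplus_{n\in\frac12+\mathbb Z}V_n$, a linear map $v\mapsto Y(v,z)=\sum_{n\in\mathbb Z}v_nz^{-n-1}$ into $(\mathrm{End}\,V)[[z,z^{-1}]]$, and vectors $\mathbf 1\in V_0$, $\omega\in V_2$ such that: $u_nv=0$ for $n\gg0$; $Y(\mathbf 1,z)=\mathrm{Id}$; $Y(v,z)\mathbf 1\in V[[z]]$ with constant term $v$; the operators $L(n)=\omega_{n+1}$ satisfy the Virasoro relations $[L(m),L(n)]=(m-n)L(m+n)+\frac1{12}(m^3-m)\delta_{m+n,0}c$; $\frac{d}{dz}Y(v,z)=Y(L(-1)v,z)$; $L(0)|_{V_n}=n$; and the Jacobi identity $$z_0^{-1}\delta\Big(\tfrac{z_1-z_2}{z_0}\Big)Y(u,z_1)Y(v,z_2)-(-1)^{\tilde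 u\tilde v}z_0^{-1}\delta\Big(\tfrac{z_2-z_1}{-z_0}\Big)Y(v,z_2)Y(u,z_1)=z_2^{-1}\delta\Big(\tfrac{z_1-z_0}{z_2}\Big)Y(Y(u,z_0)v,z_2)$$ holds, where $\delta(z)=\sum_{n\in\mathbb Z}z^n$ and $\tilde v\in\{0,1\}$ is the parity of $v$. For $v\in V_n$ write $\mathrm{wt}\,v=n$. An automorphism $g$ of $V$ is a linear automorphism with $g\omega=\omega$ and $gY(v,z)g^{-1}=Y(gv,z)$ for all $v$. Let $\sigma$ be the automorphism equal to $1$ on $V_{\bar0}$ and $-1$ on $V_{\bar1}$. Let $g$ be an automorphism of finite order, let $T$ be the order of $g\sigma$, and $V^{r*}=\{v\in V: g\sigma v=e^{2\pi i r/T}v\}$ for $0\le r\le T-1$, so $V=\bigoplus_{r}V^{r*}$. Put $\delta_r=1$ if $r=0$ and $\delta_r=0$ if $r\ne0$. For homogeneous $u\in V^{r*}$ and $v\in V$ define $$u\circ_gv=\mathrm{Res}_z\frac{(1+z)^{\mathrm{wt}\,u-1+\delta_r+r/T}}{z^{1+\delta_r}}Y(u,z)v,$$ $$u*_gv=\mathrm{Res}_z\Big(Y(u,z)\frac{(1+z)^{\mathrm{wt}\,u}}{z}v\Big)\ \text{ if } r=0,\qquad u*_gv=0\ \text{ if } r>0,$$ where $(1+z)^\alpha$ is expanded in nonnegative integer powers of $z$; extend $*_g$ bilinearly to $V$. $O_g(V)$ is the linear span of all $u\circ_gv$, and $A_g(V)=V/O_g(V)$. *)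

theory Defs
  imports
    Complex_Main
    "HOL-Library.Groups_Big_Fun"
    "HOL-Algebra.Algebraic_Closure_Type"
begin

section \<open>Vertex operator superalgebras\<close>

text \<open>
  The underlying space is the whole type. \<open>vgrade V k\<close> is the homogeneous subspace of weight
  \<open>k / 2\<close>, and \<open>vmode V v n\<close> is the operator \<open>v\<^sub>n\<close> in \<open>Y(v, z) = \<Sum> v\<^sub>n z\<^sup>-\<^sup>n\<^sup>-\<^sup>1\<close>, so that an identity
  between formal series is an identity between all of their coefficients.
\<close>

record 'v vosa =
  vscale :: "complex \<Rightarrow> 'v \<Rightarrow> 'v"
  vgrade :: "nat \<Rightarrow> 'v set"
  vmode :: "'v \<Rightarrow> int \<Rightarrow> 'v \<Rightarrow> 'v"
  vvac :: 'v
  vconf :: 'v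

abbreviation vspan :: "('v::ab_group_add) vosa \<Rightarrow> 'v set \<Rightarrow> 'v set" where
  "vspan V \<equiv> module.span (vscale V)"

abbreviation vlinear :: "('v::ab_group_add) vosa \<Rightarrow> ('v \<Rightarrow> 'v) \<Rightarrow> bool" where
  "vlinear V \<equiv> Vector_Spaces.linear (vscale V) (vscale V)"

definition weight :: "nat \<Rightarrow> complex" where
  "weight k = of_nat k / 2"

definition vparity :: "('v::ab_group_add) vosa \<Rightarrow> nat \<Rightarrow> 'v set" where
  "vparity V s = vspan V (\<Union>k\<in>{k. k mod 2 = s}. vgrade V k)"

definition virL :: "'v vosa \<Rightarrow> int \<Rightarrow> 'v \<Rightarrow> 'v" where
  "virL V n = vmode V (vconf V) (n + 1)"

text \<open>
  \<open>delta_coeff a b c\<close> is the coefficient of \<open>x\<^sup>a y\<^sup>b z\<^sup>c\<close> in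
  \<open>z\<^sup>-\<^sup>1 \<delta>((x - y) / z) = \<Sum>\<^sub>n (x - y)\<^sup>n z\<^sup>-\<^sup>n\<^sup>-\<^sup>1\<close>, where \<open>(x - y)\<^sup>n\<close> is expanded in nonnegative powers
  of the second variable \<open>y\<close>.
\<close>

definition delta_coeff :: "int \<Rightarrow> int \<Rightarrow> int \<Rightarrow> complex" where
  "delta_coeff a b c =
    (if 0 \<le> b \<and> a + b + c = - 1
     then (- 1) ^ nat b * (of_int (a + b) gchoose nat b) else 0)"

text \<open>
  The three terms of the Jacobi identity, applied to a vector \<open>w\<close>: the coefficients of
  \<open>z\<^sub>0\<^sup>a z\<^sub>1\<^sup>b z\<^sub>2\<^sup>c\<close>. The second uses
  \<open>z\<^sub>0\<^sup>-\<^sup>1 \<delta>((z\<^sub>2 - z\<^sub>1) / (-z\<^sub>0)) = \<Sum>\<^sub>n (-1)\<^sup>n (z\<^sub>2 - z\<^sub>1)\<^sup>n z\<^sub>0\<^sup>-\<^sup>n\<^sup>-\<^sup>1\<close>, where \<open>z\<^sub>0\<^sup>a\<close> occurs for \<open>n = - a - 1\<close>.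
  All sums have finite support because \<open>v\<^sub>n w = 0\<close> for large \<open>n\<close>.
\<close>

definition jacobi_term1 ::
    "('v::ab_group_add) vosa \<Rightarrow> 'v \<Rightarrow> 'v \<Rightarrow> 'v \<Rightarrow> int \<Rightarrow> int \<Rightarrow> int \<Rightarrow> 'v" where
  "jacobi_term1 V u v w a b c =
    Sum_any (\<lambda>(p, q). vscale V (delta_coeff (b + p + 1) (c + q + 1) a)
      (vmode V u p (vmode V v q w)))"

definition jacobi_term2 ::
    "('v::ab_group_add) vosa \<Rightarrow> 'v \<Rightarrow> 'v \<Rightarrow> 'v \<Rightarrow> int \<Rightarrow> int \<Rightarrow> int \<Rightarrow> 'v" where
  "jacobi_term2 V u v w a b c =
    Sum_any (\<lambda>(p, q). vscale V ((- 1) powi (- a - 1) * delta_coeff (c + q + 1) (b + p + 1) a)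
      (vmode V v q (vmode V u p w)))"

definition jacobi_term3 ::
    "('v::ab_group_add) vosa \<Rightarrow> 'v \<Rightarrow> 'v \<Rightarrow> 'v \<Rightarrow> int \<Rightarrow> int \<Rightarrow> int \<Rightarrow> 'v" where
  "jacobi_term3 V u v w a b c =
    Sum_any (\<lambda>(p, q). vscale V (delta_coeff b (a + p + 1) (c + q + 1))
      (vmode V (vmode V u p v) q w))"

locale vertex_operator_superalgebra = vector_space "vscale V"
  for V :: "('v::ab_group_add) vosa" +
  assumes grade_subspace: "module.subspace (vscale V) (vgrade V k)"
    and grade_finite_dim: "\<exists>B. finite B \<and> vspan V B = vgrade V k"
    and grade_direct_sum:
      "\<exists>!f. (\<forall>k. f k \<in> vgrade V k) \<and> finite {k. f k \<noteq> 0} \<and> v = Sum_any f"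
    and mode_linear: "vlinear V (vmode V v n)"
    and state_field_linear: "vlinear V (\<lambda>v. vmode V v n w)"
    and vac_grade: "vvac V \<in> vgrade V 0"
    and conf_grade: "vconf V \<in> vgrade V 4"
    and truncation: "\<exists>N. \<forall>n\<ge>N. vmode V u n v = 0"
    and vacuum: "vmode V (vvac V) n v = (if n = - 1 then v else 0)"
    and creation_regular: "0 \<le> n \<Longrightarrow> vmode V v n (vvac V) = 0"
    and creation: "vmode V v (- 1) (vvac V) = v"
    and virasoro: "\<exists>c. \<forall>m n v.
      virL V m (virL V n v) - virL V n (virL V m v) =
        vscale V (of_int (m - n)) (virL V (m + n) v) +
        vscale V (of_int (m ^ 3 - m) / 12 * (if m + n = 0 then 1 else 0) * c) v"
    and translation: "vmode V (virL V (- 1) v) n w = vscale V (- of_int n) (vmode V v (n - 1) w)"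
    and L0_grade: "v \<in> vgrade V k \<Longrightarrow> virL V 0 v = vscale V (weight k) v"
    and jacobi: "s \<in> {0, 1} \<Longrightarrow> t \<in> {0, 1} \<Longrightarrow> u \<in> vparity V s \<Longrightarrow> v \<in> vparity V t \<Longrightarrow>
      jacobi_term1 V u v w a b c - vscale V ((- 1) ^ (s * t)) (jacobi_term2 V u v w a b c) =
      jacobi_term3 V u v w a b c"


section \<open>Automorphisms\<close>

definition vosa_automorphism :: "('v::ab_group_add) vosa \<Rightarrow> ('v \<Rightarrow> 'v) \<Rightarrow> bool" where
  "vosa_automorphism V g \<longleftrightarrow>
    vlinear V g \<and> bij g \<and> g (vconf V) = vconf V \<and>
    (\<forall>v n w. g (vmode V v n (inv_into UNIV g w)) = vmode V (g v) n w)"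

definition has_finite_order :: "('a \<Rightarrow> 'a) \<Rightarrow> bool" where
  "has_finite_order h \<longleftrightarrow> (\<exists>n>0. h ^^ n = id)"

definition map_order :: "('a \<Rightarrow> 'a) \<Rightarrow> nat" where
  "map_order h = (LEAST n. 0 < n \<and> h ^^ n = id)"

definition sigma :: "('v::ab_group_add) vosa \<Rightarrow> 'v \<Rightarrow> 'v" where
  "sigma V = (THE s. vlinear V s \<and>
    (\<forall>v\<in>vparity V 0. s v = v) \<and> (\<forall>v\<in>vparity V 1. s v = - v))"

definition twist_order :: "('v::ab_group_add) vosa \<Rightarrow> ('v \<Rightarrow> 'v) \<Rightarrow> nat" where
  "twist_order V g = map_order (g \<circ> sigma V)"

definition twist_eigenspace :: "('v::ab_group_add) vosa \<Rightarrow> ('v \<Rightarrow> 'v) \<Rightarrow> nat \<Rightarrow> 'v set" where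
  "twist_eigenspace V g r =
    {v. g (sigma V v) =
      vscale V (exp (2 * of_real pi * \<i> * of_nat r / of_nat (twist_order V g))) v}"


section \<open>The twisted Zhu algebra\<close>

text \<open>
  \<open>residue_product V \<alpha> d u v = Res\<^sub>z ((1 + z)\<^sup>\<alpha> z\<^sup>-\<^sup>d Y(u, z) v)\<close>: the term \<open>z\<^sup>j\<^sup>-\<^sup>d\<close> pairs with \<open>u\<^sub>n z\<^sup>-\<^sup>n\<^sup>-\<^sup>1\<close>
  for \<open>n = j - d\<close>. The support of the sum is finite.
\<close>

definition residue_product ::
    "('v::ab_group_add) vosa \<Rightarrow> complex \<Rightarrow> nat \<Rightarrow> 'v \<Rightarrow> 'v \<Rightarrow> 'v" where
  "residue_product V \<alpha> d u v =
    Sum_any (\<lambda>j. vscale V (\<alpha> gchoose j) (vmode V u (int j - int d) v))"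

text \<open>\<open>zhu_circ V g r k u v\<close> is the circle product for \<open>u\<close> of weight \<open>k / 2\<close> in the \<open>r\<close>-th eigenspace.\<close>

definition zhu_circ ::
    "('v::ab_group_add) vosa \<Rightarrow> ('v \<Rightarrow> 'v) \<Rightarrow> nat \<Rightarrow> nat \<Rightarrow> 'v \<Rightarrow> 'v \<Rightarrow> 'v" where
  "zhu_circ V g r k u v =
    (let \<delta> = (if r = 0 then 1 else 0) in
     residue_product V (weight k - 1 + of_nat \<delta> + of_nat r / of_nat (twist_order V g)) (1 + \<delta>) u v)"

definition zhu_O :: "('v::ab_group_add) vosa \<Rightarrow> ('v \<Rightarrow> 'v) \<Rightarrow> 'v set" where
  "zhu_O V g = vspan V
    {zhu_circ V g r k u v | r k u v.
      r < twist_order V g \<and> u \<in> vgrade V k \<inter> twist_eigenspace V g r}"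

definition zhu_star :: "('v::ab_group_add) vosa \<Rightarrow> ('v \<Rightarrow> 'v) \<Rightarrow> 'v \<Rightarrow> 'v \<Rightarrow> 'v" where
  "zhu_star V g = (THE m.
    (\<forall>u. vlinear V (m u)) \<and> (\<forall>v. vlinear V (\<lambda>u. m u v)) \<and>
    (\<forall>r k u v. r < twist_order V g \<longrightarrow> u \<in> vgrade V k \<inter> twist_eigenspace V g r \<longrightarrow>
      m u v = (if r = 0 then residue_product V (weight k) 1 u v else 0)))"

definition zhu_class :: "('v::ab_group_add) vosa \<Rightarrow> ('v \<Rightarrow> 'v) \<Rightarrow> 'v \<Rightarrow> 'v set" where
  "zhu_class V g v = (+) v ` zhu_O V g"

text \<open>
  The operations on cosets are defined by taking the union of the cosets of all results on
  representatives (as for quotient rings in \<^theory>\<open>HOL-Algebra.QuotRing\<close>). Hence the product of the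
  classes of \<open>u\<close> and \<open>v\<close> is the class of \<open>zhu_star V g u v\<close> exactly if the product is independent of
  the representatives.
\<close>

definition zhu_algebra ::
    "('v::ab_group_add) vosa \<Rightarrow> ('v \<Rightarrow> 'v) \<Rightarrow> (complex, 'v set) module" where
  "zhu_algebra V g = \<lparr>
    carrier = range (zhu_class V g),
    monoid.mult = (\<lambda>A B. \<Union>u\<in>A. \<Union>v\<in>B. zhu_class V g (zhu_star V g u v)),
    one = zhu_class V g (vvac V),
    ring.zero = zhu_class V g 0,
    add = (\<lambda>A B. \<Union>u\<in>A. \<Union>v\<in>B. zhu_class V g (u + v)),
    module.smult = (\<lambda>c A. \<Union>u\<in>A. zhu_class V g (vscale V c u))\<rparr>"

text \<open>
  The locale \<open>algebra\<close> of HOL-Algebra is about commutative algebras. No unit is required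
  here, and the field \<open>one\<close> of the record is not constrained.
\<close>

locale associative_algebra = Module.module R A for R (structure) and A (structure) +
  assumes mult_closed: "x \<in> carrier A \<Longrightarrow> y \<in> carrier A \<Longrightarrow> x \<otimes>\<^bsub>A\<^esub> y \<in> carrier A"
    and mult_assoc: "x \<in> carrier A \<Longrightarrow> y \<in> carrier A \<Longrightarrow> z \<in> carrier A \<Longrightarrow>
      (x \<otimes>\<^bsub>A\<^esub> y) \<otimes>\<^bsub>A\<^esub> z = x \<otimes>\<^bsub>A\<^esub> (y \<otimes>\<^bsub>A\<^esub> z)"
    and mult_distl: "x \<in> carrier A \<Longrightarrow> y \<in> carrier A \<Longrightarrow> z \<in> carrier A \<Longrightarrow>
      (x \<oplus>\<^bsub>A\<^esub> y) \<otimes>\<^bsub>A\<^esub> z = x \<otimes>\<^bsub>A\<^esub> z \<oplus>\<^bsub>A\<^esub> y \<otimes>\<^bsub>A\<^esub> z"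
    and mult_distr: "x \<in> carrier A \<Longrightarrow> y \<in> carrier A \<Longrightarrow> z \<in> carrier A \<Longrightarrow>
      x \<otimes>\<^bsub>A\<^esub> (y \<oplus>\<^bsub>A\<^esub> z) = x \<otimes>\<^bsub>A\<^esub> y \<oplus>\<^bsub>A\<^esub> x \<otimes>\<^bsub>A\<^esub> z"
    and smult_mult_left: "c \<in> carrier R \<Longrightarrow> x \<in> carrier A \<Longrightarrow> y \<in> carrier A \<Longrightarrow>
      (c \<odot>\<^bsub>A\<^esub> x) \<otimes>\<^bsub>A\<^esub> y = c \<odot>\<^bsub>A\<^esub> (x \<otimes>\<^bsub>A\<^esub> y)"
    and smult_mult_right: "c \<in> carrier R \<Longrightarrow> x \<in> carrier A \<Longrightarrow> y \<in> carrier A \<Longrightarrow>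
      x \<otimes>\<^bsub>A\<^esub> (c \<odot>\<^bsub>A\<^esub> y) = c \<odot>\<^bsub>A\<^esub> (x \<otimes>\<^bsub>A\<^esub> y)"

definition algebra_unit :: "('a, 'b, 'c) module_scheme \<Rightarrow> 'b \<Rightarrow> bool" where
  "algebra_unit A e \<longleftrightarrow>
    e \<in> carrier A \<and> (\<forall>x\<in>carrier A. e \<otimes>\<^bsub>A\<^esub> x = x \<and> x \<otimes>\<^bsub>A\<^esub> e = x)"

definition algebra_center :: "('a, 'b, 'c) module_scheme \<Rightarrow> 'b set" where
  "algebra_center A = {z \<in> carrier A. \<forall>x\<in>carrier A. z \<otimes>\<^bsub>A\<^esub> x = x \<otimes>\<^bsub>A\<^esub> z}"

end

theory Submission
  imports Defs "HOL-Computational_Algebra.Formal_Laurent_Series"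
begin

text \<open>
  Write \<open>u\<^sub>f = Res\<^sub>z (f(z) Y(u, z))\<close> for a Laurent series \<open>f\<close>. The Borcherds identity, extended from
  monomials to Laurent series, expresses combinations of modes of the vectors \<open>u\<^sub>l\<^sub>+\<^sub>i v\<close> through the products \<open>u\<^sub>F v\<^sub>H\<close> and
  \<open>v\<^sub>H u\<^sub>F\<close>. By translation covariance \<open>O\<^sub>g(V)\<close> contains all \<open>u\<^sub>F v\<close> whose \<open>F\<close> is \<open>(1 + z)\<^sup>n z\<^sup>-\<^sup>m\<close> times
  the series in the circle product, \<open>n \<le> m\<close>. The case \<open>l = 0\<close> shows that \<open>O\<^sub>g(V)\<close> is a left ideal. The
  cases \<open>l = -1, -2\<close> show that it is a right ideal and that the product is associative modulo
  \<open>O\<^sub>g(V)\<close>, because the factor \<open>(z\<^sub>1 - z\<^sub>2)\<^sup>l\<close> raises the order of the poles of all terms but one; in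
  contrast to Zhu's argument, skew symmetry is not needed. For the conformal vector, the
  commutator of \<open>\<omega>\<^sub>-\<^sub>1\<close> with \<open>v\<^sub>f\<close>, applied to the vacuum, gives
  \<open>\<omega> * v - v * \<omega> \<equiv> (2 - wt v) (L(-1) v + wt v v)\<close>, and \<open>L(-1) v + wt v v = v \<circ> 1\<close>.
\<close>

unbundle fps_syntax

section \<open>Formal Laurent series\<close>

text \<open>The series \<open>(1 + z)^\<alpha> * z^m\<close>, with the power of \<open>1 + z\<close>
  expanded at \<open>z = 0\<close>. Both products of the twisted theory are residues against such
  series, and \<open>\<alpha> = 0\<close> gives the monomials.\<close>

definition binomial_fls :: "complex \<Rightarrow> int \<Rightarrow> complex fls" where
  "binomial_fls \<alpha> m = fls_shift (- m) (fps_to_fls (fps_binomial \<alpha>))"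

lemma binomial_fls_nth:
  "binomial_fls \<alpha> m $$ n = (if m \<le> n then \<alpha> gchoose nat (n - m) else 0)"
  by (simp add: binomial_fls_def)

lemma binomial_fls_conv_times:
  "binomial_fls \<alpha> m = fps_to_fls (fps_binomial \<alpha>) * fls_X_intpow m"
  by (simp add: binomial_fls_def fls_X_intpow_times_conv_shift)

lemma binomial_fls_mult:
  "binomial_fls \<alpha> m * binomial_fls \<beta> n = binomial_fls (\<alpha> + \<beta>) (m + n)"
  by (simp add: binomial_fls_def fls_shifted_times_simps fps_binomial_add_mult fls_times_fps_to_fls)

lemma binomial_fls_0: "binomial_fls 0 m = fls_X_intpow m"
  by (simp add: binomial_fls_conv_times)

lemma binomial_fls_0_0 [simp]: "binomial_fls 0 0 = 1"
  by (simp add: binomial_fls_def)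

text \<open>Multiplication by \<open>1 + z\<close>. This is what allows a factor
  \<open>1 + z\<close> to be exchanged for poles of different orders.\<close>

lemma binomial_fls_add_one: "binomial_fls (\<alpha> + 1) m = binomial_fls \<alpha> m + binomial_fls \<alpha> (m + 1)"
proof -
  have "binomial_fls 1 0 = binomial_fls 0 0 + binomial_fls 0 1"
    by (rule fls_eqI) (auto simp: binomial_fls_def fps_binomial_1)
  then show ?thesis
    using binomial_fls_mult[of \<alpha> m 1 0] binomial_fls_mult[of \<alpha> m 0 0] binomial_fls_mult[of \<alpha> m 0 1]
    by (simp add: distrib_left)
qed

lemma fls_deriv_binomial_fls_0:
  "fls_deriv (binomial_fls \<alpha> 0) = fls_const \<alpha> * binomial_fls (\<alpha> - 1) 0"
proof (rule fls_eqI)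
  fix n :: int
  have "of_nat (Suc k) * (\<alpha> gchoose Suc k) = \<alpha> * (\<alpha> - 1 gchoose k)" for k
    by (rule gbinomial_absorption)
  note * = this[of "nat n"]
  show "fls_deriv (binomial_fls \<alpha> 0) $$ n = (fls_const \<alpha> * binomial_fls (\<alpha> - 1) 0) $$ n"
  proof (cases "n \<ge> 0")
    case True
    then have "nat (n + 1) = Suc (nat n)" by simp
    with * True show ?thesis by (simp add: binomial_fls_nth add.commute)
  next
    case False
    \<comment> \<open>At \<open>n = - 1\<close> the constant coefficient of the series is nonzero,
      but differentiation multiplies it by \<open>n + 1 = 0\<close>.\<close>
    then have "n = - 1 \<or> n < - 1" by auto
    then show ?thesis by (auto simp: binomial_fls_nth)
  qed
qed

lemma fls_deriv_binomial_fls: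
  "fls_deriv (binomial_fls \<alpha> m) =
    fls_const \<alpha> * binomial_fls (\<alpha> - 1) m + fls_const (of_int m) * binomial_fls \<alpha> (m - 1)"
proof -
  have *: "binomial_fls \<alpha> m = binomial_fls \<alpha> 0 * binomial_fls 0 m"
    by (simp add: binomial_fls_mult)
  have "fls_deriv (binomial_fls 0 m) = fls_const (of_int m) * binomial_fls 0 (m - 1)"
    by (simp add: binomial_fls_0 fls_deriv_X_intpow fls_of_int)
  then show ?thesis
    unfolding * fls_deriv_mult fls_deriv_binomial_fls_0
    by (simp add: mult.assoc mult.left_commute binomial_fls_mult)
qed

text \<open>The divided derivative, that is, the coefficient of \<open>z0^i\<close> in the Taylor
  expansion of \<open>f(z + z0)\<close>.\<close>

definition hasse_deriv :: "nat \<Rightarrow> complex fls \<Rightarrow> complex fls" where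
  "hasse_deriv i f = fls_const (inverse (fact i)) * (fls_deriv ^^ i) f"

lemma funpow_fls_deriv_add:
  "(fls_deriv ^^ i) (f + g) = (fls_deriv ^^ i) f + (fls_deriv ^^ i) (g :: complex fls)"
  by (induction i arbitrary: f g) (simp_all add: funpow_swap1)

lemma funpow_fls_deriv_const:
  "(fls_deriv ^^ i) (fls_const c * f) = fls_const c * (fls_deriv ^^ i) (f :: complex fls)"
  by (induction i arbitrary: f) (simp_all add: funpow_swap1)

lemma hasse_deriv_add: "hasse_deriv i (f + g) = hasse_deriv i f + hasse_deriv i g"
  by (simp add: hasse_deriv_def funpow_fls_deriv_add distrib_left)

lemma hasse_deriv_const: "hasse_deriv i (fls_const c * f) = fls_const c * hasse_deriv i f"
  by (simp add: hasse_deriv_def funpow_fls_deriv_const mult.left_commute)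

lemma fls_const_scale_scale: "fls_const a * (fls_const b * f) = fls_const (a * b) * f"
  for f :: "complex fls"
  by (simp add: mult.assoc[symmetric])

lemma hasse_deriv_Suc:
  "hasse_deriv (Suc i) f = fls_const (inverse (of_nat (Suc i))) * fls_deriv (hasse_deriv i f)"
proof -
  have "inverse (fact (Suc i)) = inverse (of_nat (Suc i)) * (inverse (fact i) :: complex)"
    by (simp add: field_simps del: of_nat_Suc)
  then show ?thesis
    unfolding hasse_deriv_def fls_deriv_mult_const_left fls_const_scale_scale by simp
qed

lemma hasse_deriv_nth_eq_0:
  assumes "\<And>n. n < M \<Longrightarrow> f $$ n = 0" "n < M - int i"
  shows "hasse_deriv i f $$ n = 0"
proof -
  have "n < M - int i \<Longrightarrow> (fls_deriv ^^ i) f $$ n = 0"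
    by (induction i arbitrary: n) (simp_all add: assms(1))
  with assms(2) show ?thesis
    by (simp add: hasse_deriv_def)
qed

lemma hasse_deriv_binomial_fls:
  "hasse_deriv i (binomial_fls \<alpha> 0) =
    fls_const (\<alpha> gchoose i) * binomial_fls (\<alpha> - of_nat i) 0"
proof (induction i)
  case (Suc i)
  have *: "inverse (of_nat (Suc i)) * ((\<alpha> gchoose i) * (\<alpha> - of_nat i)) = (\<alpha> gchoose Suc i)"
    using gbinomial_mult_1[of \<alpha> i] by (simp add: field_simps del: of_nat_Suc)
  show ?case
    unfolding hasse_deriv_Suc Suc.IH fls_deriv_mult_const_left fls_deriv_binomial_fls
    by (simp add: fls_const_scale_scale *[unfolded of_nat_Suc] diff_diff_eq add.commute)
qed (simp add: hasse_deriv_def)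

lemma hasse_deriv_X_intpow:
  "hasse_deriv i (binomial_fls 0 m) =
    fls_const (of_int m gchoose i) * binomial_fls 0 (m - int i)"
proof (induction i)
  case (Suc i)
  have *: "inverse (of_nat (Suc i)) * ((of_int m gchoose i) * (of_int m - of_nat i)) =
      ((of_int m :: complex) gchoose Suc i)"
    using gbinomial_mult_1[of "of_int m :: complex" i] by (simp add: field_simps del: of_nat_Suc)
  show ?case
    unfolding hasse_deriv_Suc Suc.IH fls_deriv_mult_const_left fls_deriv_binomial_fls
    by (simp add: fls_const_scale_scale *[unfolded of_nat_Suc] diff_diff_eq add.commute)
qed (simp add: hasse_deriv_def)

text \<open>By the Leibniz rule the divided derivative is a linear combination of the series in
  \<open>binom\<close>: \<open>j\<close> of the \<open>i\<close> derivatives fall on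
  \<open>z^m\<close>, the others on the power of \<open>1 + z\<close>. Stating this through a
  property closed under linear combinations avoids computing the coefficients.\<close>

lemma hasse_deriv_binomial_fls_induct:
  assumes add: "\<And>f g. K f \<Longrightarrow> K g \<Longrightarrow> K (f + g)"
    and scale: "\<And>c f. K f \<Longrightarrow> K (fls_const c * f)"
    and binom: "\<And>j. j \<le> i \<Longrightarrow> K (binomial_fls (\<alpha> - of_nat i + of_nat j) (m - int j))"
  shows "K (hasse_deriv i (binomial_fls \<alpha> m))"
proof -
  have "K ((fls_deriv ^^ i) (binomial_fls \<alpha> m))"
    if "\<And>f g. K f \<Longrightarrow> K g \<Longrightarrow> K (f + g)" "\<And>c f. K f \<Longrightarrow> K (fls_const c * f)"
      "\<And>j. j \<le> i \<Longrightarrow> K (binomial_fls (\<alpha> - of_nat i + of_nat j) (m - int j))" for K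
    using that
  proof (induction i arbitrary: K)
    case (Suc i)
    have "K (fls_deriv ((fls_deriv ^^ i) (binomial_fls \<alpha> m)))"
    \<comment> \<open>The outermost derivative is absorbed into the property, which is why
      \<open>K\<close> has to be general in the induction. Its two terms then have the indices
      \<open>j\<close> and \<open>Suc j\<close>.\<close>
    proof (rule Suc.IH[of "\<lambda>f. K (fls_deriv f)"])
      fix j assume j: "j \<le> i"
      have "K (binomial_fls (\<alpha> - of_nat i + of_nat j - 1) (m - int j))"
        using Suc.prems(3)[of j] j by (simp add: algebra_simps)
      moreover have "K (binomial_fls (\<alpha> - of_nat i + of_nat j) (m - int j - 1))"
        using Suc.prems(3)[of "Suc j"] j by (simp add: algebra_simps)
      ultimately show "K (fls_deriv (binomial_fls (\<alpha> - of_nat i + of_nat j) (m - int j)))"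
        unfolding fls_deriv_binomial_fls by (intro Suc.prems(1,2))
    qed (simp_all add: Suc.prems)
    then show ?case by simp
  qed simp
  from this[OF assms] show ?thesis
    unfolding hasse_deriv_def by (rule scale)
qed

text \<open>A Laurent series is a finite sum of monomials plus a series of arbitrarily high order.
  An additive property therefore only has to be checked on monomials and on all series beyond one
  fixed order \<open>M\<close>.\<close>

lemma fls_truncation_induct:
  assumes tail: "\<exists>M. \<forall>f. (\<forall>n<M. f $$ n = 0) \<longrightarrow> P f"
    and monomial: "\<And>c m. P (fls_const c * binomial_fls 0 m)"
    and add: "\<And>f g. P f \<Longrightarrow> P g \<Longrightarrow> P (f + g)"
  shows "P (f :: complex fls)"
proof -
  obtain M where M: "\<And>f. \<forall>n<M. f $$ n = 0 \<Longrightarrow> P f"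
    using tail by blast
  have *: "(\<forall>n < M - int j. f $$ n = 0) \<Longrightarrow> P f" for j f
  proof (induction j arbitrary: f)
    case (Suc j)
    \<comment> \<open>Removing the term of lowest possible exponent raises the lower bound for the
      order by one.\<close>
    let ?m = "M - int (Suc j)"
    let ?x = "fls_const (f $$ ?m) * binomial_fls 0 ?m"
    have "P (f - ?x)"
      by (rule Suc.IH) (use Suc.prems in \<open>auto simp: binomial_fls_nth gbinomial_0_left intro!: arg_cong[of _ _ "($$) f"]\<close>)
    from add[OF this monomial[of "f $$ ?m" ?m]] show ?case by simp
  qed (simp add: M)
  have "\<forall>n < fls_subdegree f. f $$ n = 0"
    by (simp add: fls_eq0_below_subdegree)
  then have "\<forall>n < M - int (nat (M - fls_subdegree f)). f $$ n = 0"
    by auto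
  then show ?thesis by (rule *)
qed

section \<open>Residues against Laurent series\<close>

context vertex_operator_superalgebra
begin

lemma module_hom_mode: "module_hom (vscale V) (vscale V) (vmode V u n)"
  by (simp add: module_hom_iff_linear mode_linear)

lemma module_hom_state: "module_hom (vscale V) (vscale V) (\<lambda>u. vmode V u n v)"
  by (simp add: module_hom_iff_linear state_field_linear)

lemmas mode_add = module_hom.add[OF module_hom_mode] module_hom.add[OF module_hom_state]
lemmas mode_scale = module_hom.scale[OF module_hom_mode] module_hom.scale[OF module_hom_state]
lemmas mode_zero [simp] = module_hom.zero[OF module_hom_mode] module_hom.zero[OF module_hom_state]

text \<open>\<open>residue f u v\<close> is \<open>Res\<^sub>z (f(z) Y(u, z) v)\<close>.\<close>

definition residue :: "complex fls \<Rightarrow> 'v \<Rightarrow> 'v \<Rightarrow> 'v" where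
  "residue f u v = Sum_any (\<lambda>n. vscale V (f $$ n) (vmode V u n v))"

lemma residue_eq_sum:
  assumes "\<And>n. n < a \<Longrightarrow> f $$ n = 0" "\<And>n. b \<le> n \<Longrightarrow> vmode V u n v = 0"
  shows "residue f u v = (\<Sum>n\<in>{a..<b}. vscale V (f $$ n) (vmode V u n v))"
  unfolding residue_def
proof (rule Sum_any.expand_superset)
  show "{n. vscale V (f $$ n) (vmode V u n v) \<noteq> 0} \<subseteq> {a..<b}"
  proof
    fix n assume "n \<in> {n. vscale V (f $$ n) (vmode V u n v) \<noteq> 0}"
    then have "f $$ n \<noteq> 0" "vmode V u n v \<noteq> 0" by auto
    with assms show "n \<in> {a..<b}" by (meson atLeastLessThan_iff not_le)
  qed
qed simp

lemma residue_eq_0: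
  assumes "\<And>n. n < a \<Longrightarrow> f $$ n = 0" "\<And>n. a \<le> n \<Longrightarrow> vmode V u n v = 0"
  shows "residue f u v = 0"
  using residue_eq_sum[OF assms, of a] by simp

text \<open>The symmetric ranges exhaust the integers, so finitely many residues can be compared
  over one common range. An identity free of \<open>N\<close> that holds eventually holds
  outright.\<close>

lemma eventually_residue_eq_sum:
  "\<forall>\<^sub>F N in sequentially.
    residue f u v = (\<Sum>n\<in>{- int N..<int N}. vscale V (f $$ n) (vmode V u n v))"
proof -
  obtain b where b: "\<forall>n\<ge>b. vmode V u n v = 0"
    using truncation by blast
  show ?thesis
  proof (rule eventually_sequentiallyI)
    fix N assume N: "nat (max b (- fls_subdegree f)) \<le> N"
    show "residue f u v = (\<Sum>n\<in>{- int N..<int N}. vscale V (f $$ n) (vmode V u n v))"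
    proof (rule residue_eq_sum)
      show "f $$ n = 0" if "n < - int N" for n
        using that N by (intro fls_eq0_below_subdegree) linarith
      show "vmode V u n v = 0" if "int N \<le> n" for n
        using that N b by auto
    qed
  qed
qed

lemma residue_add_series: "residue (f + g) u v = residue f u v + residue g u v"
proof -
  have "\<forall>\<^sub>F N in sequentially. residue (f + g) u v = residue f u v + residue g u v"
    using eventually_residue_eq_sum[of "f + g" u v] eventually_residue_eq_sum[of f u v]
      eventually_residue_eq_sum[of g u v]
    by eventually_elim (simp add: sum.distrib scale_left_distrib)
  then show ?thesis by simp
qed

lemma residue_scale_series: "residue (fls_const c * f) u v = vscale V c (residue f u v)"
proof -
  have "\<forall>\<^sub>F N in sequentially. residue (fls_const c * f) u v = vscale V c (residue f u v)"
    using eventually_residue_eq_sum[of "fls_const c * f" u v] eventually_residue_eq_sum[of f u v]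
    by eventually_elim (simp add: scale_sum_right)
  then show ?thesis by simp
qed

lemma residue_minus_series: "residue (- f) u v = - residue f u v"
  using residue_scale_series[of "- 1" f u v] by simp

lemma residue_linear_vector: "vlinear V (residue f u)"
  unfolding Vector_Spaces.linear_iff
proof (intro conjI allI)
  fix x y c
  have "\<forall>\<^sub>F N in sequentially. residue f u (x + y) = residue f u x + residue f u y"
    using eventually_residue_eq_sum[of f u "x + y"] eventually_residue_eq_sum[of f u x]
      eventually_residue_eq_sum[of f u y]
    by eventually_elim (simp add: sum.distrib scale_right_distrib mode_add)
  then show "residue f u (x + y) = residue f u x + residue f u y" by simp
  have "\<forall>\<^sub>F N in sequentially. residue f u (vscale V c x) = vscale V c (residue f u x)"
    using eventually_residue_eq_sum[of f u "vscale V c x"] eventually_residue_eq_sum[of f u x]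
    by eventually_elim (simp add: scale_sum_right mode_scale mult.commute)
  then show "residue f u (vscale V c x) = vscale V c (residue f u x)" by simp
qed (rule vector_space_axioms)+

lemma residue_linear_state: "vlinear V (\<lambda>u. residue f u v)"
  unfolding Vector_Spaces.linear_iff
proof (intro conjI allI)
  fix x y c
  have "\<forall>\<^sub>F N in sequentially. residue f (x + y) v = residue f x v + residue f y v"
    using eventually_residue_eq_sum[of f "x + y" v] eventually_residue_eq_sum[of f x v]
      eventually_residue_eq_sum[of f y v]
    by eventually_elim (simp add: sum.distrib scale_right_distrib mode_add)
  then show "residue f (x + y) v = residue f x v + residue f y v" by simp
  have "\<forall>\<^sub>F N in sequentially. residue f (vscale V c x) v = vscale V c (residue f x v)"
    using eventually_residue_eq_sum[of f "vscale V c x" v] eventually_residue_eq_sum[of f x v]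
    by eventually_elim (simp add: scale_sum_right mode_scale mult.commute)
  then show "residue f (vscale V c x) v = vscale V c (residue f x v)" by simp
qed (rule vector_space_axioms)+

lemma module_hom_residue:
  "module_hom (vscale V) (vscale V) (residue f u)"
  "module_hom (vscale V) (vscale V) (\<lambda>u. residue f u v)"
  by (simp_all add: module_hom_iff_linear residue_linear_vector residue_linear_state)

lemmas residue_add = module_hom_residue[THEN module_hom.add]
lemmas residue_scale = module_hom_residue[THEN module_hom.scale]
lemmas residue_zero [simp] = module_hom_residue[THEN module_hom.zero]

lemma residue_X_intpow: "residue (binomial_fls 0 m) u v = vmode V u m v"
proof -
  have "residue (binomial_fls 0 m) u v =
      Sum_any (\<lambda>n. if n = m then vmode V u n v else 0)"
    unfolding residue_def
    by (rule Sum_any.cong) (auto simp: binomial_fls_nth gbinomial_0_left)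
  then show ?thesis by simp
qed

lemma residue_mem_subspace:
  assumes "module.subspace (vscale V) S" "\<And>n. vmode V u n v \<in> S"
  shows "residue f u v \<in> S"
proof -
  have "\<forall>\<^sub>F N in sequentially. residue f u v \<in> S"
    using eventually_residue_eq_sum[of f u v]
    by eventually_elim (simp add: subspace_sum subspace_scale assms)
  then show ?thesis by simp
qed

text \<open>Integration by parts, since \<open>Y(L(-1) u, z)\<close> is the derivative of
  \<open>Y(u, z)\<close> and a derivative has residue zero.\<close>

lemma residue_translation: "residue f (virL V (- 1) u) v = - residue (fls_deriv f) u v"
proof -
  have "residue (fls_deriv (- f)) u v = residue f (virL V (- 1) u) v"
    unfolding residue_def
  proof (rule Sum_any.reindex_cong)
    show "bij (\<lambda>n::int. n - 1)"
      by (rule bijI') (auto intro: exI[of _ "_ + 1"])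
    show "(\<lambda>n. vscale V (fls_deriv (- f) $$ n) (vmode V u n v)) \<circ> (\<lambda>n. n - 1) =
        (\<lambda>n. vscale V (f $$ n) (vmode V (virL V (- 1) u) n v))"
      by (simp add: fun_eq_iff translation mult.commute)
  qed
  then show ?thesis
    by (simp add: residue_minus_series)
qed

text \<open>The bridge from the given definitions to residues: the summation index \<open>j\<close>
  becomes the mode \<open>n = j - d\<close>.\<close>

lemma residue_product_eq_residue:
  "residue_product V \<alpha> d u v = residue (binomial_fls \<alpha> (- int d)) u v"
proof -
  obtain b where b: "\<forall>n\<ge>b. vmode V u n v = 0"
    using truncation by blast
  let ?N = "nat (b + int d)"
  have "residue (binomial_fls \<alpha> (- int d)) u v =
      (\<Sum>n\<in>{- int d..<int ?N - int d}. vscale V (binomial_fls \<alpha> (- int d) $$ n) (vmode V u n v))"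
  proof (rule residue_eq_sum)
    fix n assume "int ?N - int d \<le> n"
    then have "b \<le> n" by linarith
    with b show "vmode V u n v = 0" by blast
  qed (simp add: binomial_fls_nth)
  also have "{- int d..<int ?N - int d} = (\<lambda>j. int j - int d) ` {..<?N}"
  proof (intro subset_antisym subsetI)
    fix n assume n: "n \<in> {- int d..<int ?N - int d}"
    then have "0 \<le> n + int d" "n + int d < int ?N"
      by simp_all
    then have "n = int (nat (n + int d)) - int d" "nat (n + int d) < ?N"
      by (simp_all only: nat_less_iff)
    then show "n \<in> (\<lambda>j. int j - int d) ` {..<?N}" by blast
  qed auto
  also have "(\<Sum>n\<in>(\<lambda>j. int j - int d) ` {..<?N}.
        vscale V (binomial_fls \<alpha> (- int d) $$ n) (vmode V u n v)) =
      (\<Sum>j<?N. vscale V (\<alpha> gchoose j) (vmode V u (int j - int d) v))"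
    by (subst sum.reindex) (auto simp: inj_on_def binomial_fls_nth)
  also have "\<dots> = residue_product V \<alpha> d u v"
    unfolding residue_product_def
  proof (rule Sum_any.expand_superset[symmetric])
    show "{j. vscale V (\<alpha> gchoose j) (vmode V u (int j - int d) v) \<noteq> 0} \<subseteq> {..<?N}"
    proof
      fix j assume "j \<in> {j. vscale V (\<alpha> gchoose j) (vmode V u (int j - int d) v) \<noteq> 0}"
      then have "vmode V u (int j - int d) v \<noteq> 0" by auto
      with b have "int j - int d < b" by (meson not_le)
      then show "j \<in> {..<?N}" by auto
    qed
  qed simp
  finally show ?thesis by simp
qed

section \<open>Bounds beyond which modes and coefficients vanish\<close>

lemma ex_uniform_truncation: "\<exists>K. \<forall>i<I. \<forall>n\<ge>K. vmode V (x i) n (y i) = 0" for I :: nat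
proof (induction I)
  case (Suc I)
  then obtain K where K: "\<forall>i<I. \<forall>n\<ge>K. vmode V (x i) n (y i) = 0" by blast
  obtain K' where K': "\<forall>n\<ge>K'. vmode V (x I) n (y I) = 0" using truncation by blast
  show ?case
    by (rule exI[of _ "max K K'"]) (use K K' in \<open>auto simp: less_Suc_eq\<close>)
qed simp

lemma ex_state_truncation: "\<exists>I. \<forall>i\<ge>I. vmode V u (l + int i) v = 0" for I :: nat
proof -
  obtain K where "\<forall>n\<ge>K. vmode V u n v = 0" using truncation by blast
  then show ?thesis by (intro exI[of _ "nat (K - l)"]) auto
qed

lemma fls_mult_nth_eq_0:
  assumes "\<And>n. n < a \<Longrightarrow> f $$ n = 0" "\<And>n. n < b \<Longrightarrow> g $$ n = 0" "n < a + b"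
  shows "(f * g :: complex fls) $$ n = 0"
proof (cases "f = 0 \<or> g = 0")
  case False
  have "a \<le> fls_subdegree f" "b \<le> fls_subdegree g"
    using False assms(1,2) nth_fls_subdegree_nonzero by (meson not_le)+
  with False assms(3) show ?thesis
    by (intro fls_eq0_below_subdegree) simp
qed auto

lemma ex_residue_shift_eq_0: "\<exists>I. \<forall>i\<ge>I. residue (h * binomial_fls 0 (int i)) v w = 0"
proof -
  obtain K where K: "\<forall>n\<ge>K. vmode V v n w = 0" using truncation by blast
  have "residue (h * binomial_fls 0 (int i)) v w = 0" if "i \<ge> nat (K - fls_subdegree h)" for i
  proof (rule residue_eq_0)
    fix n assume "n < K"
    then show "(h * binomial_fls 0 (int i)) $$ n = 0"
      by (intro fls_mult_nth_eq_0[of "fls_subdegree h" _ "int i"])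
        (use that in \<open>auto simp: binomial_fls_nth\<close>)
  qed (use K in auto)
  then show ?thesis by blast
qed

section \<open>The Borcherds identity\<close>

lemma grade_vparity: "u \<in> vgrade V k \<Longrightarrow> u \<in> vparity V (k mod 2)"
  unfolding vparity_def by (rule span_base) auto

text \<open>In \<open>delta_coeff\<close> the exponents must add up to \<open>- 1\<close>, which
  confines each double sum of the Jacobi identity to a line. Truncation leaves a finite segment of
  it, here parametrised by \<open>i\<close>.\<close>

lemma Sum_any_line:
  fixes F :: "int \<Rightarrow> int \<Rightarrow> 'v" and N :: nat
  assumes "\<And>p q. F p q \<noteq> 0 \<Longrightarrow> \<exists>i<N. p = P i \<and> q = Q i" "inj Q"
  shows "Sum_any (\<lambda>(p, q). F p q) = (\<Sum>i<N. F (P i) (Q i))"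
proof -
  have "Sum_any (\<lambda>(p, q). F p q) = (\<Sum>(p, q)\<in>(\<lambda>i. (P i, Q i)) ` {..<N}. F p q)"
    by (rule Sum_any.expand_superset) (use assms(1) in force)+
  also have "\<dots> = (\<Sum>i<N. F (P i) (Q i))"
    by (subst sum.reindex) (use assms(2) in \<open>auto simp: inj_def inj_on_def\<close>)
  finally show ?thesis .
qed

text \<open>This compares the coefficients of \<open>z0^(-l-1) z1^(-m-1) z2^(-n-1)\<close> in the
  Jacobi identity. All three sums are finite by truncation, and any \<open>N\<close> beyond the
  three bounds serves as a common range.\<close>

lemma borcherds_modes:
  assumes u: "u \<in> vgrade V k" and v: "v \<in> vgrade V k'"
  shows "\<forall>\<^sub>F N in sequentially.
    (\<Sum>i<N. vscale V (of_int m gchoose i) (vmode V (vmode V u (l + int i) v) (m + n - int i) w)) =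
    (\<Sum>i<N. vscale V ((- 1) ^ i * (of_int l gchoose i))
      (vmode V u (m + l - int i) (vmode V v (n + int i) w) -
       vscale V ((- 1) ^ (k * k') * (- 1) powi l)
        (vmode V v (n + l - int i) (vmode V u (m + int i) w))))"
proof -
  let ?a = "- l - 1" and ?b = "- m - 1" and ?c = "- n - 1"
  obtain I where I: "\<forall>i\<ge>I. vmode V v (n + int i) w = 0" using ex_state_truncation by blast
  obtain J where J: "\<forall>i\<ge>J. vmode V u (m + int i) w = 0" using ex_state_truncation by blast
  obtain K where K: "\<forall>i\<ge>K. vmode V u (l + int i) v = 0" using ex_state_truncation by blast
  \<comment> \<open>The Jacobi identity takes parities in \<open>{0, 1}\<close>, whereas
    \<open>k\<close> and \<open>k'\<close> are doubled weights; the sign only sees them modulo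
    2.\<close>
  have par: "(- 1 :: complex) ^ ((k mod 2) * (k' mod 2)) = (- 1) ^ (k * k')"
    by (metis mod_mult_eq neg_one_even_power neg_one_odd_power even_mod_2_iff even_mult_iff)
  have jac: "jacobi_term1 V u v w ?a ?b ?c -
      vscale V ((- 1) ^ (k * k')) (jacobi_term2 V u v w ?a ?b ?c) = jacobi_term3 V u v w ?a ?b ?c"
    unfolding par[symmetric]
    by (rule jacobi) (use grade_vparity[OF u] grade_vparity[OF v] in auto)
  show ?thesis
  proof (rule eventually_sequentiallyI)
    fix N assume "max I (max J K) \<le> N"
    then have N: "I \<le> N" "J \<le> N" "K \<le> N" by auto
    have t1: "jacobi_term1 V u v w ?a ?b ?c = (\<Sum>i<N. vscale V ((- 1) ^ i * (of_int l gchoose i))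
        (vmode V u (m + l - int i) (vmode V v (n + int i) w)))"
      unfolding jacobi_term1_def
    proof (subst Sum_any_line[where N = N and P = "\<lambda>i. m + l - int i" and Q = "\<lambda>i. n + int i"])
      fix p q
      assume nz: "vscale V (delta_coeff (?b + p + 1) (?c + q + 1) ?a) (vmode V u p (vmode V v q w)) \<noteq> 0"
      then have "delta_coeff (?b + p + 1) (?c + q + 1) ?a \<noteq> 0" "vmode V v q w \<noteq> 0" by auto
      then have *: "n \<le> q" "p = m + l - (q - n)" "vmode V v (n + int (nat (q - n))) w \<noteq> 0"
        by (auto simp: delta_coeff_def split: if_splits)
      with I N have "nat (q - n) < N" by (meson le_trans not_le)
      with * show "\<exists>i<N. p = m + l - int i \<and> q = n + int i"
        by (intro exI[of _ "nat (q - n)"]) auto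
    qed (auto simp: inj_def delta_coeff_def)
    have t2: "jacobi_term2 V u v w ?a ?b ?c = (\<Sum>i<N. vscale V ((- 1) ^ i * (of_int l gchoose i))
        (vscale V ((- 1) powi l) (vmode V v (n + l - int i) (vmode V u (m + int i) w))))"
      unfolding jacobi_term2_def
    proof (subst Sum_any_line[where N = N and P = "\<lambda>i. m + int i" and Q = "\<lambda>i. n + l - int i"])
      fix p q
      assume nz: "vscale V ((- 1) powi (- ?a - 1) * delta_coeff (?c + q + 1) (?b + p + 1) ?a)
          (vmode V v q (vmode V u p w)) \<noteq> 0"
      then have "delta_coeff (?c + q + 1) (?b + p + 1) ?a \<noteq> 0" "vmode V u p w \<noteq> 0" by auto
      then have *: "m \<le> p" "q = n + l - (p - m)" "vmode V u (m + int (nat (p - m))) w \<noteq> 0"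
        by (auto simp: delta_coeff_def split: if_splits)
      with J N have "nat (p - m) < N" by (meson le_trans not_le)
      with * show "\<exists>i<N. p = m + int i \<and> q = n + l - int i"
        by (intro exI[of _ "nat (p - m)"]) auto
    qed (auto simp: inj_def delta_coeff_def mult_ac)
    have t3: "jacobi_term3 V u v w ?a ?b ?c = (\<Sum>i<N. vscale V (of_int m gchoose i)
        (vmode V (vmode V u (l + int i) v) (m + n - int i) w))"
      unfolding jacobi_term3_def
    proof (subst Sum_any_line[where N = N and P = "\<lambda>i. l + int i" and Q = "\<lambda>i. m + n - int i"])
      fix p q
      assume nz: "vscale V (delta_coeff ?b (?a + p + 1) (?c + q + 1))
          (vmode V (vmode V u p v) q w) \<noteq> 0"
      then have "delta_coeff ?b (?a + p + 1) (?c + q + 1) \<noteq> 0" "vmode V u p v \<noteq> 0" by auto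
      then have *: "l \<le> p" "q = m + n - (p - l)" "vmode V u (l + int (nat (p - l))) v \<noteq> 0"
        by (auto simp: delta_coeff_def split: if_splits)
      with K N have "nat (p - l) < N" by (meson le_trans not_le)
      with * show "\<exists>i<N. p = l + int i \<and> q = m + n - int i"
        by (intro exI[of _ "nat (p - l)"]) auto
    next
      \<comment> \<open>The expansion of the delta function gives \<open>(- 1)^i\<close> times the
        binomial coefficient of \<open>i - m - 1\<close>; negating the upper argument turns this
        into that of \<open>m\<close>.\<close>
      have "delta_coeff ?b (?a + (l + int i) + 1) (?c + (m + n - int i) + 1) = of_int m gchoose i"
        for i
        by (simp add: delta_coeff_def gbinomial_negated_upper[of "of_int m" i] algebra_simps)
      then show "(\<Sum>i<N. vscale V (delta_coeff ?b (?a + (l + int i) + 1) (?c + (m + n - int i) + 1))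
            (vmode V (vmode V u (l + int i) v) (m + n - int i) w)) =
          (\<Sum>i<N. vscale V (of_int m gchoose i)
            (vmode V (vmode V u (l + int i) v) (m + n - int i) w))"
        by simp
    qed (auto simp: inj_def)
    show "(\<Sum>i<N. vscale V (of_int m gchoose i)
          (vmode V (vmode V u (l + int i) v) (m + n - int i) w)) =
        (\<Sum>i<N. vscale V ((- 1) ^ i * (of_int l gchoose i))
          (vmode V u (m + l - int i) (vmode V v (n + int i) w) -
           vscale V ((- 1) ^ (k * k') * (- 1) powi l)
            (vmode V v (n + l - int i) (vmode V u (m + int i) w))))"
      using jac unfolding t1 t2 t3
      by (simp add: scale_right_diff_distrib sum_subtractf scale_sum_right ac_simps)
  qed
qed

text \<open>
  The previous identity with \<open>z\<^sub>1\<^sup>m\<close> and \<open>z\<^sub>2\<^sup>n\<close> replaced by Laurent series \<open>f(z\<^sub>1)\<close> and \<open>h(z\<^sub>2)\<close>: the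
  binomial coefficients of \<open>m\<close> become the Taylor coefficients of \<open>f(z\<^sub>2 + z\<^sub>0)\<close>. It is bilinear in
  \<open>f\<close> and \<open>h\<close>, and by truncation it only depends on finitely many coefficients of each.
\<close>

definition borcherds_series ::
    "nat \<Rightarrow> nat \<Rightarrow> int \<Rightarrow> 'v \<Rightarrow> 'v \<Rightarrow> 'v \<Rightarrow> complex fls \<Rightarrow> complex fls \<Rightarrow> bool" where
  "borcherds_series k k' l u v w f h \<longleftrightarrow> (\<forall>\<^sub>F N in sequentially.
    (\<Sum>i<N. residue (hasse_deriv i f * h) (vmode V u (l + int i) v) w) =
    (\<Sum>i<N. vscale V ((- 1) ^ i * (of_int l gchoose i))
      (residue (f * binomial_fls 0 (l - int i)) u (residue (h * binomial_fls 0 (int i)) v w) -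
       vscale V ((- 1) ^ (k * k') * (- 1) powi l)
        (residue (h * binomial_fls 0 (l - int i)) v (residue (f * binomial_fls 0 (int i)) u w)))))"

lemma borcherds_series_add_left:
  assumes "borcherds_series k k' l u v w f h" "borcherds_series k k' l u v w f' h"
  shows "borcherds_series k k' l u v w (f + f') h"
  using assms unfolding borcherds_series_def
  by eventually_elim
    (simp add: hasse_deriv_add distrib_right residue_add_series residue_add sum.distrib
      scale_right_distrib scale_right_diff_distrib sum_subtractf add_diff_add)

lemma borcherds_series_add_right:
  assumes "borcherds_series k k' l u v w f h" "borcherds_series k k' l u v w f h'"
  shows "borcherds_series k k' l u v w f (h + h')"
  using assms unfolding borcherds_series_def
  by eventually_elim
    (simp add: distrib_right distrib_left residue_add_series residue_add sum.distrib
      scale_right_distrib scale_right_diff_distrib sum_subtractf add_diff_add)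

lemma borcherds_series_monomial:
  assumes "u \<in> vgrade V k" "v \<in> vgrade V k'"
  shows "borcherds_series k k' l u v w
    (fls_const c * binomial_fls 0 m) (fls_const d * binomial_fls 0 n)"
  unfolding borcherds_series_def using borcherds_modes[OF assms, of m l n w]
proof eventually_elim
  case (elim N)
  have 1: "hasse_deriv i (fls_const c * binomial_fls 0 m) * (fls_const d * binomial_fls 0 n) =
      fls_const (c * d * (of_int m gchoose i)) * binomial_fls 0 (m + n - int i)" for i
    by (simp add: hasse_deriv_const hasse_deriv_X_intpow binomial_fls_mult
        fls_const_mult_const[symmetric] ac_simps del: fls_const_mult_const)
      (metis (no_types, opaque_lifting) add.commute binomial_fls_mult
        diff_add_eq mult.assoc mult.commute add_0)
  have 2: "residue (fls_const a * binomial_fls 0 p * binomial_fls 0 q) =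
      (\<lambda>x y. vscale V a (vmode V x (p + q) y))" for a p q
    by (simp add: fun_eq_iff mult.assoc binomial_fls_mult residue_scale_series residue_X_intpow)
  from arg_cong[OF elim, of "vscale V (c * d)"]
  show ?case
    unfolding 1 2 residue_scale_series residue_X_intpow
    by (simp add: scale_sum_right mode_scale
        scale_right_diff_distrib mult.commute mult.left_commute add.commute add.left_commute add_diff_eq)
qed

text \<open>If \<open>f\<close> has high order, every term on both sides vanishes: for almost all
  \<open>i\<close> by truncation independently of \<open>f\<close>, and for the finitely many others
  because the series multiplying the outer field starts beyond its last nonzero mode.\<close>

lemma borcherds_series_tail_left:
  "\<exists>M. \<forall>f. (\<forall>n<M. f $$ n = 0) \<longrightarrow> borcherds_series k k' l u v w f h"
proof -
  let ?s = "fls_subdegree h"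
  obtain I where I: "\<forall>i\<ge>I. vmode V u (l + int i) v = 0" using ex_state_truncation by blast
  obtain J where J: "\<forall>i\<ge>J. residue (h * binomial_fls 0 (int i)) v w = 0"
    using ex_residue_shift_eq_0 by blast
  obtain A where A: "\<forall>i<I. \<forall>n\<ge>A. vmode V (vmode V u (l + int i) v) n w = 0"
    using ex_uniform_truncation[of I "\<lambda>i. vmode V u (l + int i) v" "\<lambda>i. w"] by blast
  obtain B where B: "\<forall>i<J. \<forall>n\<ge>B. vmode V u n (residue (h * binomial_fls 0 (int i)) v w) = 0"
    using ex_uniform_truncation[of J "\<lambda>i. u" "\<lambda>i. residue (h * binomial_fls 0 (int i)) v w"] by blast
  obtain C where C: "\<forall>n\<ge>C. vmode V u n w = 0" using truncation by blast
  \<comment> \<open>The summands \<open>int I\<close> and \<open>int J\<close> make up for the order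
    lost through \<open>hasse_deriv i\<close> and through the factor
    \<open>z^(l - i)\<close>.\<close>
  define M where "M = max (A - ?s + int I) (max (B - l + int J) C)"
  have "borcherds_series k k' l u v w f h" if f: "\<forall>n<M. f $$ n = 0" for f
  proof -
    have 1: "residue (hasse_deriv i f * h) (vmode V u (l + int i) v) w = 0" for i
    proof (cases "i < I")
      case True
      show ?thesis
      proof (rule residue_eq_0)
        fix n assume "n < A"
        with True show "(hasse_deriv i f * h) $$ n = 0"
          by (intro fls_mult_nth_eq_0[of "M - int i" _ ?s] hasse_deriv_nth_eq_0[of M])
            (use f in \<open>auto simp: M_def\<close>)
      qed (use A True in auto)
    qed (use I in auto)
    have 2: "residue (f * binomial_fls 0 (l - int i)) u (residue (h * binomial_fls 0 (int i)) v w) = 0"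
      for i
    proof (cases "i < J")
      case True
      show ?thesis
      proof (rule residue_eq_0)
        fix n assume "n < B"
        with True show "(f * binomial_fls 0 (l - int i)) $$ n = 0"
          by (intro fls_mult_nth_eq_0[of M _ "l - int i"])
            (use f in \<open>auto simp: M_def binomial_fls_nth\<close>)
      qed (use B True in auto)
    qed (use J in auto)
    have 3: "residue (f * binomial_fls 0 (int i)) u w = 0" for i
    proof (rule residue_eq_0)
      fix n assume "n < C"
      then show "(f * binomial_fls 0 (int i)) $$ n = 0"
        by (intro fls_mult_nth_eq_0[of M _ "int i"])
          (use f in \<open>auto simp: M_def binomial_fls_nth\<close>)
    qed (use C in auto)
    show ?thesis
      by (simp add: borcherds_series_def 1 2 3)
  qed
  then show ?thesis by blast
qed

lemma borcherds_series_tail_right: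
  "\<exists>M. \<forall>h. (\<forall>n<M. h $$ n = 0) \<longrightarrow> borcherds_series k k' l u v w f h"
proof -
  let ?s = "fls_subdegree f"
  obtain I where I: "\<forall>i\<ge>I. vmode V u (l + int i) v = 0" using ex_state_truncation by blast
  obtain J where J: "\<forall>i\<ge>J. residue (f * binomial_fls 0 (int i)) u w = 0"
    using ex_residue_shift_eq_0 by blast
  obtain A where A: "\<forall>i<I. \<forall>n\<ge>A. vmode V (vmode V u (l + int i) v) n w = 0"
    using ex_uniform_truncation[of I "\<lambda>i. vmode V u (l + int i) v" "\<lambda>i. w"] by blast
  obtain B where B: "\<forall>i<J. \<forall>n\<ge>B. vmode V v n (residue (f * binomial_fls 0 (int i)) u w) = 0"
    using ex_uniform_truncation[of J "\<lambda>i. v" "\<lambda>i. residue (f * binomial_fls 0 (int i)) u w"] by blast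
  obtain C where C: "\<forall>n\<ge>C. vmode V v n w = 0" using truncation by blast
  define M where "M = max (A - ?s + int I) (max (B - l + int J) C)"
  have "borcherds_series k k' l u v w f h" if h: "\<forall>n<M. h $$ n = 0" for h
  proof -
    have 1: "residue (hasse_deriv i f * h) (vmode V u (l + int i) v) w = 0" for i
    proof (cases "i < I")
      case True
      show ?thesis
      proof (rule residue_eq_0)
        fix n assume "n < A"
        with True show "(hasse_deriv i f * h) $$ n = 0"
          by (intro fls_mult_nth_eq_0[of "?s - int i" _ M] hasse_deriv_nth_eq_0[of ?s])
            (use h in \<open>auto simp: M_def\<close>)
      qed (use A True in auto)
    qed (use I in auto)
    have 2: "residue (h * binomial_fls 0 (l - int i)) v (residue (f * binomial_fls 0 (int i)) u w) = 0"
      for i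
    proof (cases "i < J")
      case True
      show ?thesis
      proof (rule residue_eq_0)
        fix n assume "n < B"
        with True show "(h * binomial_fls 0 (l - int i)) $$ n = 0"
          by (intro fls_mult_nth_eq_0[of M _ "l - int i"])
            (use h in \<open>auto simp: M_def binomial_fls_nth\<close>)
      qed (use B True in auto)
    qed (use J in auto)
    have 3: "residue (h * binomial_fls 0 (int i)) v w = 0" for i
    proof (rule residue_eq_0)
      fix n assume "n < C"
      then show "(h * binomial_fls 0 (int i)) $$ n = 0"
        by (intro fls_mult_nth_eq_0[of M _ "int i"])
          (use h in \<open>auto simp: M_def binomial_fls_nth\<close>)
    qed (use C in auto)
    show ?thesis
      by (simp add: borcherds_series_def 1 2 3)
  qed
  then show ?thesis by blast
qed

text \<open>Two nested reductions to monomials: first in \<open>f\<close> for the given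
  \<open>h\<close>, then in \<open>h\<close> for a fixed monomial \<open>f\<close>.\<close>

lemma borcherds:
  assumes "u \<in> vgrade V k" "v \<in> vgrade V k'"
  shows "borcherds_series k k' l u v w f h"
proof (rule fls_truncation_induct[where f = f])
  fix c m
  show "borcherds_series k k' l u v w (fls_const c * binomial_fls 0 m) h"
    by (rule fls_truncation_induct[where f = h])
      (intro borcherds_series_tail_right borcherds_series_monomial borcherds_series_add_right assms;
        assumption)+
qed (intro borcherds_series_tail_left borcherds_series_add_left; assumption)+

section \<open>Weights and parity\<close>

definition component :: "'v \<Rightarrow> nat \<Rightarrow> 'v" where
  "component v = (THE f. (\<forall>k. f k \<in> vgrade V k) \<and> finite {k. f k \<noteq> 0} \<and> v = Sum_any f)"

lemma component_grade: "component v k \<in> vgrade V k"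
  and finite_component: "finite {k. component v k \<noteq> 0}"
  and Sum_any_component: "Sum_any (component v) = v"
  using theI'[OF grade_direct_sum[of v]] unfolding component_def by auto

lemma component_unique:
  "(\<And>k. f k \<in> vgrade V k) \<Longrightarrow> finite {k. f k \<noteq> 0} \<Longrightarrow> Sum_any f = v \<Longrightarrow> component v = f"
  unfolding component_def by (rule the1_equality[OF grade_direct_sum]) auto

lemma zero_grade [simp]: "0 \<in> vgrade V k"
  by (rule subspace_0[OF grade_subspace])

lemma component_eq_sum: "v = (\<Sum>k | component v k \<noteq> 0. component v k)"
  by (metis Sum_any.expand_set Sum_any_component)

lemma component_of_grade:
  assumes "v \<in> vgrade V k"
  shows "component v = (\<lambda>j. if j = k then v else 0)"
  by (rule component_unique) (use assms in auto)

lemma component_add: "component (x + y) k = component x k + component y k"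
proof -
  have "component (x + y) = (\<lambda>k. component x k + component y k)"
  proof (rule component_unique)
    show "finite {k. component x k + component y k \<noteq> 0}"
      by (rule finite_subset[of _ "{k. component x k \<noteq> 0} \<union> {k. component y k \<noteq> 0}"])
        (auto simp: finite_component)
    show "Sum_any (\<lambda>k. component x k + component y k) = x + y"
      by (simp add: Sum_any.distrib finite_component Sum_any_component)
  qed (intro subspace_add[OF grade_subspace] component_grade)
  then show ?thesis by simp
qed

lemma Sum_any_hom:
  assumes "module_hom (vscale V) (vscale V) h" "finite {k. f k \<noteq> 0}"
  shows "h (Sum_any f) = Sum_any (\<lambda>k. h (f k))"
proof -
  interpret h: module_hom "vscale V" "vscale V" h by (rule assms(1))
  have "Sum_any (\<lambda>k. h (f k)) = sum (\<lambda>k. h (f k)) {k. f k \<noteq> 0}"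
    by (rule Sum_any.expand_superset) (use assms(2) in \<open>auto intro: ccontr\<close>)
  then show ?thesis
    by (simp add: Sum_any.expand_set h.sum)
qed

lemma component_hom:
  assumes h: "module_hom (vscale V) (vscale V) h"
    and grade: "\<And>k v. v \<in> vgrade V k \<Longrightarrow> h v \<in> vgrade V k"
  shows "component (h v) k = h (component v k)"
proof -
  interpret h: module_hom "vscale V" "vscale V" h by (rule h)
  have "component (h v) = (\<lambda>k. h (component v k))"
  proof (rule component_unique)
    show "finite {k. h (component v k) \<noteq> 0}"
      by (rule finite_subset[OF _ finite_component[of v]]) auto
    show "Sum_any (\<lambda>k. h (component v k)) = h v"
      using Sum_any_hom[OF h finite_component[of v]] by (simp add: Sum_any_component)
  qed (intro grade component_grade)
  then show ?thesis by simp
qed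

lemma module_hom_scale: "module_hom (vscale V) (vscale V) (vscale V c)"
  by (simp add: module_hom_iff module_axioms scale_right_distrib scale_left_commute)

lemma component_scale: "component (vscale V c v) k = vscale V c (component v k)"
  by (rule component_hom[OF module_hom_scale subspace_scale[OF grade_subspace]])

lemma grade_induct:
  assumes "module_hom (vscale V) (vscale V) h" "module_hom (vscale V) (vscale V) h'"
    "\<And>k v. v \<in> vgrade V k \<Longrightarrow> h v = h' v"
  shows "h v = h' v"
proof -
  interpret h: module_hom "vscale V" "vscale V" h by (rule assms)
  interpret h': module_hom "vscale V" "vscale V" h' by (rule assms)
  have "h (\<Sum>k | component v k \<noteq> 0. component v k) = h' (\<Sum>k | component v k \<noteq> 0. component v k)"
    unfolding h.sum h'.sum by (intro sum.cong refl assms(3)[OF component_grade])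
  then show ?thesis
    by (simp add: component_eq_sum[symmetric])
qed

lemma module_hom_virL: "module_hom (vscale V) (vscale V) (virL V n)"
  unfolding virL_def by (rule module_hom_mode)

lemma L0_eigenvector:
  assumes "virL V 0 v = vscale V c v" "component v k \<noteq> 0"
  shows "c = weight k"
proof -
  have "component (virL V 0 v) k = vscale V (weight k) (component v k)"
    by (subst component_hom[OF module_hom_virL])
      (auto simp: L0_grade component_grade intro: subspace_scale[OF grade_subspace])
  then have "vscale V (c - weight k) (component v k) = 0"
    by (simp add: assms component_scale scale_left_diff_distrib)
  with assms(2) show ?thesis by simp
qed

lemma inj_weight: "weight j = weight k \<longleftrightarrow> j = k"
  by (simp add: weight_def)

text \<open>Distinct indices have distinct weights, so the homogeneous subspaces are the full
  eigenspaces of \<open>L(0)\<close>. Weights of modes and of images under \<open>g\<close> can thus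
  be read off from the action of \<open>L(0)\<close>.\<close>

lemma L0_eigenvector_grade:
  assumes "virL V 0 v = vscale V (weight k) v"
  shows "v \<in> vgrade V k"
proof -
  have "component v j = 0" if "j \<noteq> k" for j
    using L0_eigenvector[OF assms] that by (metis inj_weight)
  then have "Sum_any (component v) = component v k"
    by (subst Sum_any.expand_superset[of "{k}"]) auto
  then show ?thesis
    by (metis Sum_any_component component_grade)
qed

lemma sum_lessThan_trunc:
  fixes f :: "nat \<Rightarrow> 'v"
  assumes "M \<le> N" "\<And>i. M \<le> i \<Longrightarrow> f i = 0"
  shows "(\<Sum>i<N. f i) = (\<Sum>i<M. f i)"
  by (rule sum.mono_neutral_right) (use assms in auto)

text \<open>The Borcherds identity for the conformal vector with \<open>l = 0\<close> and
  \<open>m = 1\<close> expresses the commutator of \<open>L(0)\<close> with \<open>u_n\<close> as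
  the sum of the modes \<open>n + 1\<close> of \<open>L(-1) u\<close> and \<open>n\<close> of
  \<open>L(0) u\<close>; translation covariance evaluates the former.\<close>

lemma L0_mode:
  assumes u: "u \<in> vgrade V k" and v: "v \<in> vgrade V l"
  shows "virL V 0 (vmode V u n v) =
    vscale V (weight k + weight l - of_int n - 1) (vmode V u n v)"
proof -
  let ?\<omega> = "vconf V"
  \<comment> \<open>With \<open>m = 1\<close> only \<open>i = 0\<close> and \<open>i = 1\<close>
    survive on the left, hence the requirement \<open>2 \<le> N\<close> below.\<close>
  have one: "(1 :: complex) gchoose i = 0" if "i \<ge> 2" for i
    using that binomial_gbinomial[of 1 i, where 'a = complex] by (simp add: binomial_eq_0)
  have "\<forall>\<^sub>F N in sequentially. 2 \<le> N \<and>
    (\<Sum>i<N. vscale V (of_int 1 gchoose i) (vmode V (vmode V ?\<omega> (0 + int i) u) (1 + n - int i) v)) =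
    (\<Sum>i<N. vscale V ((- 1) ^ i * (of_int 0 gchoose i))
      (vmode V ?\<omega> (1 + 0 - int i) (vmode V u (n + int i) v) -
       vscale V ((- 1) ^ (4 * k) * (- 1) powi 0)
        (vmode V u (n + 0 - int i) (vmode V ?\<omega> (1 + int i) v))))"
    by (intro eventually_conj eventually_ge_at_top borcherds_modes conf_grade u)
  then obtain N where N: "2 \<le> N" and eq:
    "(\<Sum>i<N. vscale V (of_int 1 gchoose i) (vmode V (vmode V ?\<omega> (0 + int i) u) (1 + n - int i) v)) =
    (\<Sum>i<N. vscale V ((- 1) ^ i * (of_int 0 gchoose i))
      (vmode V ?\<omega> (1 + 0 - int i) (vmode V u (n + int i) v) -
       vscale V ((- 1) ^ (4 * k) * (- 1) powi 0)
        (vmode V u (n + 0 - int i) (vmode V ?\<omega> (1 + int i) v))))"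
    using eventually_happens'[OF sequentially_bot] by blast
  have L: "(\<Sum>i<N. vscale V (of_int 1 gchoose i)
        (vmode V (vmode V ?\<omega> (0 + int i) u) (1 + n - int i) v)) =
      vmode V (virL V (- 1) u) (n + 1) v + vmode V (virL V 0 u) n v"
    by (subst sum_lessThan_trunc[OF N]) (auto simp: one virL_def numeral_2_eq_2 add.commute)
  have R: "(\<Sum>i<N. vscale V ((- 1) ^ i * (of_int 0 gchoose i))
      (vmode V ?\<omega> (1 + 0 - int i) (vmode V u (n + int i) v) -
       vscale V ((- 1) ^ (4 * k) * (- 1) powi 0)
        (vmode V u (n + 0 - int i) (vmode V ?\<omega> (1 + int i) v)))) =
      virL V 0 (vmode V u n v) - vmode V u n (virL V 0 v)"
    by (subst sum_lessThan_trunc[of 1]) (use N in \<open>auto simp: gbinomial_0_left virL_def power_mult\<close>)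
  have "virL V 0 (vmode V u n v) =
      vmode V u n (virL V 0 v) + (vmode V (virL V (- 1) u) (n + 1) v + vmode V (virL V 0 u) n v)"
    using eq unfolding L R by (simp add: algebra_simps)
  also have "\<dots> = vscale V (weight l) (vmode V u n v) +
      (vscale V (- of_int (n + 1)) (vmode V u n v) + vscale V (weight k) (vmode V u n v))"
    by (simp add: L0_grade[OF u] L0_grade[OF v] mode_scale translation del: of_int_add)
  also have "\<dots> = vscale V (weight k + weight l - of_int n - 1) (vmode V u n v)"
    unfolding scale_left_distrib[symmetric] by (intro arg_cong2[where f = "vscale V"] refl) simp
  finally show ?thesis .
qed

lemma weight_nat: "0 \<le> z \<Longrightarrow> weight (nat z) = of_int z / 2"
  by (simp add: weight_def)

text \<open>The integer in the last premise is twice the weight that the vector would have, and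
  there are no negative weights.\<close>

lemma mode_eq_0:
  assumes "u \<in> vgrade V k" "v \<in> vgrade V l" "int k + int l - 2 * n - 2 < 0"
  shows "vmode V u n v = 0"
proof -
  have "component (vmode V u n v) j = 0" for j
  proof (rule ccontr)
    assume "component (vmode V u n v) j \<noteq> 0"
    from L0_eigenvector[OF L0_mode[OF assms(1,2)] this]
    have "2 * (weight k + weight l - of_int n - 1) = 2 * weight j" by simp
    then have "of_int (int k + int l - 2 * n - 2) = (of_int (int j) :: complex)"
      by (simp add: weight_def algebra_simps)
    then have "int k + int l - 2 * n - 2 = int j"
      unfolding of_int_eq_iff .
    with assms(3) show False by simp
  qed
  then show ?thesis
    by (subst component_eq_sum) simp
qed

lemma mode_grade:
  assumes "u \<in> vgrade V k" "v \<in> vgrade V l"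
  shows "vmode V u n v \<in> vgrade V (nat (int k + int l - 2 * n - 2))"
proof (cases "int k + int l - 2 * n - 2 < 0")
  case False
  then have "weight (nat (int k + int l - 2 * n - 2)) = weight k + weight l - of_int n - 1"
    by (simp add: weight_nat) (simp add: weight_def field_simps)
  with L0_mode[OF assms, of n] show ?thesis
    by (intro L0_eigenvector_grade) simp
qed (simp add: mode_eq_0[OF assms])

text \<open>
  The parity automorphism is only specified by a definite description, so it has to be
  constructed first.
\<close>

lemma sigma_properties: "vlinear V (sigma V)" "v \<in> vgrade V k \<Longrightarrow> sigma V v = vscale V ((- 1) ^ k) v"
proof -
  define s where "s v = Sum_any (\<lambda>k. vscale V ((- 1) ^ k) (component v k))" for v
  have fin: "finite {k. vscale V ((- 1) ^ k) (component v k) \<noteq> 0}" for v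
    by (rule finite_subset[OF _ finite_component[of v]]) auto
  have s: "module_hom (vscale V) (vscale V) s"
    unfolding module_hom_iff
  proof (intro conjI allI module_axioms)
    show "s (x + y) = s x + s y" for x y
      unfolding s_def component_add scale_right_distrib by (rule Sum_any.distrib[OF fin fin])
    show "s (vscale V c x) = vscale V c (s x)" for c x
    proof -
      have "s (vscale V c x) = Sum_any (\<lambda>k. vscale V c (vscale V ((- 1) ^ k) (component x k)))"
        unfolding s_def component_scale by (rule Sum_any.cong) (rule scale_left_commute)
      then show ?thesis
        unfolding s_def by (simp only: Sum_any_hom[OF module_hom_scale fin])
    qed
  qed
  have s_grade: "s v = vscale V ((- 1) ^ k) v" if "v \<in> vgrade V k" for v k
    unfolding s_def component_of_grade[OF that]
    by (subst Sum_any.expand_superset[of "{k}"]) auto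
  \<comment> \<open>\<open>vparity\<close> is a span, so equality of linear maps on it reduces to
    homogeneous vectors.\<close>
  have hom_span: "h v = h' v" if "module_hom (vscale V) (vscale V) h"
    "module_hom (vscale V) (vscale V) h'"
    "\<And>v. v \<in> S \<Longrightarrow> h v = h' v" "v \<in> vspan V S" for h h' S v
    using that by (rule module_pair.module_hom_eq_on_span[OF module_pair.intro[OF module_axioms module_axioms]])
  have "sigma V = s"
    unfolding sigma_def
  proof (rule the_equality)
    have "s v = vscale V 1 v" if "v \<in> vparity V 0" for v
      by (rule hom_span[OF s module_hom_scale _ that[unfolded vparity_def]])
        (auto simp: s_grade)
    moreover have "s v = vscale V (- 1) v" if "v \<in> vparity V 1" for v
      by (rule hom_span[OF s module_hom_scale _ that[unfolded vparity_def]])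
        (auto simp: s_grade minus_one_power_iff)
    ultimately show "vlinear V s \<and> (\<forall>v\<in>vparity V 0. s v = v) \<and> (\<forall>v\<in>vparity V 1. s v = - v)"
      using s by (simp add: module_hom_iff_linear)
  next
    fix s' assume s': "vlinear V s' \<and> (\<forall>v\<in>vparity V 0. s' v = v) \<and> (\<forall>v\<in>vparity V 1. s' v = - v)"
    show "s' = s"
    proof
      fix v
      show "s' v = s v"
      proof (rule grade_induct[OF _ s])
        show "module_hom (vscale V) (vscale V) s'"
          using s' by (simp add: module_hom_iff_linear)
        show "s' v = s v" if v: "v \<in> vgrade V k" for k v
          using s' grade_vparity[OF v] s_grade[OF v]
          by (cases "even k") (auto simp: odd_iff_mod_2_eq_one even_iff_mod_2_eq_zero)
      qed
    qed
  qed
  then show "vlinear V (sigma V)" "v \<in> vgrade V k \<Longrightarrow> sigma V v = vscale V ((- 1) ^ k) v"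
    using s s_grade by (simp_all add: module_hom_iff_linear)
qed

section \<open>Commutators and the action on the vacuum\<close>

lemma eventually_residue_binomial_fls:
  "\<forall>\<^sub>F N in sequentially. residue (binomial_fls \<alpha> (- int d)) u v =
    (\<Sum>j<N. vscale V (\<alpha> gchoose j) (vmode V u (- int d + int j) v))"
proof -
  obtain J where J: "\<forall>j\<ge>J. vmode V u (- int d + int j) v = 0" using ex_state_truncation by blast
  have "residue_product V \<alpha> d u v =
    (\<Sum>j<N. vscale V (\<alpha> gchoose j) (vmode V u (int j - int d) v))" if "J \<le> N" for N
    unfolding residue_product_def
  proof (rule Sum_any.expand_superset)
    have "vmode V u (int j - int d) v = 0" if "\<not> j < N" for j
      using J[rule_format, of j] \<open>J \<le> N\<close> that by simp
    then show "{j. vscale V (\<alpha> gchoose j) (vmode V u (int j - int d) v) \<noteq> 0} \<subseteq> {..<N}"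
      by auto
  qed simp
  then show ?thesis
    by (intro eventually_sequentiallyI[of J]) (simp add: residue_product_eq_residue)
qed

text \<open>The Borcherds identity for \<open>l = 0\<close>, where the binomial coefficient of
  \<open>l\<close> leaves only \<open>i = 0\<close> on the right.\<close>

lemma commutator:
  assumes "u \<in> vgrade V k" "v \<in> vgrade V k'"
  shows "\<forall>\<^sub>F N in sequentially.
    (\<Sum>i<N. residue (hasse_deriv i f * h) (vmode V u (int i) v) w) =
    residue f u (residue h v w) - vscale V ((- 1) ^ (k * k')) (residue h v (residue f u w))"
  using borcherds[OF assms, of 0 w f h, unfolded borcherds_series_def] eventually_ge_at_top[of "1 :: nat"]
proof eventually_elim
  case (elim N)
  note elim(1)
  also have "(\<Sum>i<N. vscale V ((- 1) ^ i * (of_int 0 gchoose i))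
      (residue (f * binomial_fls 0 (0 - int i)) u (residue (h * binomial_fls 0 (int i)) v w) -
       vscale V ((- 1) ^ (k * k') * (- 1) powi 0)
        (residue (h * binomial_fls 0 (0 - int i)) v (residue (f * binomial_fls 0 (int i)) u w)))) =
    residue f u (residue h v w) - vscale V ((- 1) ^ (k * k')) (residue h v (residue f u w))"
    by (subst sum_lessThan_trunc[OF elim(2)]) (auto simp: gbinomial_0_left)
  finally show ?case by simp
qed

lemma residue_vac: "residue (binomial_fls \<alpha> (- 1)) v (vvac V) = v"
proof -
  have "residue (binomial_fls \<alpha> (- 1)) v (vvac V) =
      (\<Sum>n\<in>{- 1..<0}. vscale V (binomial_fls \<alpha> (- 1) $$ n) (vmode V v n (vvac V)))"
    by (rule residue_eq_sum) (simp_all add: binomial_fls_nth creation_regular)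
  also have "{- 1..<0 :: int} = {- 1}" by auto
  finally show ?thesis by (simp add: binomial_fls_nth creation)
qed

text \<open>Only the modes \<open>- 2\<close> and \<open>- 1\<close> of \<open>v\<close> act
  nontrivially on the vacuum here. Creation applied to \<open>L(-1) v\<close>, with translation
  covariance, identifies the former.\<close>

lemma residue_vac_2:
  "residue (binomial_fls \<alpha> (- 2)) v (vvac V) = virL V (- 1) v + vscale V \<alpha> v"
proof -
  have "vmode V v (- 2) (vvac V) = vmode V (virL V (- 1) v) (- 1) (vvac V)"
    by (simp add: translation)
  also have "\<dots> = virL V (- 1) v" by (rule creation)
  finally have L: "vmode V v (- 2) (vvac V) = virL V (- 1) v" .
  have "residue (binomial_fls \<alpha> (- 2)) v (vvac V) =
      (\<Sum>n\<in>{- 2..<0}. vscale V (binomial_fls \<alpha> (- 2) $$ n) (vmode V v n (vvac V)))"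
    by (rule residue_eq_sum) (simp_all add: binomial_fls_nth creation_regular)
  also have "{- 2..<0 :: int} = {- 2, - 1}" by auto
  finally show ?thesis by (simp add: binomial_fls_nth creation L)
qed

end

section \<open>Eigenspaces of the automorphism\<close>

locale vosa_finite_automorphism = vertex_operator_superalgebra V
  for V :: "('v::ab_group_add) vosa" +
  fixes g :: "'v \<Rightarrow> 'v"
  assumes automorphism: "vosa_automorphism V g"
    and finite_order: "has_finite_order g"
begin

abbreviation "T \<equiv> twist_order V g"
abbreviation "E \<equiv> twist_eigenspace V g"

lemma module_hom_g: "module_hom (vscale V) (vscale V) g"
  using automorphism by (simp add: vosa_automorphism_def module_hom_iff_linear)

lemma g_conf [simp]: "g (vconf V) = vconf V"
  using automorphism by (simp add: vosa_automorphism_def)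

lemma g_mode: "g (vmode V u n w) = vmode V (g u) n (g w)"
proof -
  have "g (vmode V u n (inv_into UNIV g (g w))) = vmode V (g u) n (g w)" "bij g"
    using automorphism by (simp_all add: vosa_automorphism_def)
  then show ?thesis by (simp add: bij_is_inj)
qed

text \<open>As \<open>g\<close> is onto, the vacuum is \<open>g w\<close> for some \<open>w\<close>.
  The mode \<open>- 1\<close> of \<open>g (vvac V)\<close> fixes \<open>g w\<close> because
  \<open>g\<close> respects modes, and it creates \<open>g (vvac V)\<close> from the vacuum.\<close>

lemma g_vac [simp]: "g (vvac V) = vvac V"
proof -
  have "surj g"
    using automorphism by (simp add: vosa_automorphism_def bij_is_surj)
  then obtain w where w: "vvac V = g w" by auto
  have "g (vvac V) = vmode V (g (vvac V)) (- 1) (g w)"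
    by (simp add: creation w[symmetric])
  also have "\<dots> = g w"
    by (simp add: g_mode[symmetric] vacuum)
  finally show ?thesis using w by simp
qed

lemma g_grade: "v \<in> vgrade V k \<Longrightarrow> g v \<in> vgrade V k"
proof (rule L0_eigenvector_grade)
  assume "v \<in> vgrade V k"
  have "virL V 0 (g v) = g (virL V 0 v)"
    by (simp add: virL_def g_mode)
  also have "\<dots> = vscale V (weight k) (g v)"
    by (simp add: L0_grade[OF \<open>v \<in> vgrade V k\<close>] module_hom.scale[OF module_hom_g])
  finally show "virL V 0 (g v) = vscale V (weight k) (g v)" .
qed

definition twist :: "'v \<Rightarrow> 'v" where
  "twist = g \<circ> sigma V"

lemma module_hom_twist: "module_hom (vscale V) (vscale V) twist"
  unfolding twist_def
  by (rule module_hom_compose[OF _ module_hom_g]) (simp add: module_hom_iff_linear sigma_properties)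

lemma twist_of_grade: "v \<in> vgrade V k \<Longrightarrow> twist v = vscale V ((- 1) ^ k) (g v)"
  by (simp add: twist_def sigma_properties module_hom.scale[OF module_hom_g])

lemma twist_grade: "v \<in> vgrade V k \<Longrightarrow> twist v \<in> vgrade V k"
  by (simp add: twist_of_grade subspace_scale[OF grade_subspace] g_grade)

lemma module_hom_funpow:
  assumes "module_hom (vscale V) (vscale V) h"
  shows "module_hom (vscale V) (vscale V) (h ^^ n)"
proof (induction n)
  case 0
  show ?case by (simp add: module_hom_iff module_axioms)
next
  case (Suc n)
  show ?case unfolding funpow.simps by (rule module_hom_compose[OF Suc assms])
qed

lemma funpow_g_grade: "v \<in> vgrade V k \<Longrightarrow> (g ^^ n) v \<in> vgrade V k"
  by (induction n) (simp_all add: g_grade)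

lemma funpow_twist_of_grade:
  "v \<in> vgrade V k \<Longrightarrow> (twist ^^ n) v = vscale V ((- 1) ^ (k * n)) ((g ^^ n) v)"
  by (induction n)
    (simp_all add: module_hom.scale[OF module_hom_twist] twist_of_grade[OF funpow_g_grade] power_add mult.commute)

text \<open>On a vector of doubled weight \<open>k\<close> the \<open>n\<close>-th power of the
  twist is \<open>(- 1)^(k * n)\<close> times that of \<open>g\<close>. Doubling a period of
  \<open>g\<close> removes the sign, so the set whose least element defines \<open>T\<close> is
  nonempty.\<close>

lemma twist_order_properties: "0 < T" "twist ^^ T = id"
proof -
  obtain n where n: "n > 0" "g ^^ n = id"
    using finite_order by (auto simp: has_finite_order_def)
  have "(twist ^^ (n * 2)) v = (id :: 'v \<Rightarrow> 'v) v" for v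
  proof (rule grade_induct[OF module_hom_funpow[OF module_hom_twist]])
    show "module_hom (vscale V) (vscale V) (id :: 'v \<Rightarrow> 'v)"
      by (simp add: module_hom_iff module_axioms)
    show "(twist ^^ (n * 2)) v = id v" if "v \<in> vgrade V k" for k v
    proof -
      have "g ^^ (n * 2) = id" "(- 1 :: complex) ^ (k * (n * 2)) = 1"
        by (simp_all add: mult_2_right funpow_add n minus_one_power_iff)
      then show ?thesis by (simp add: funpow_twist_of_grade[OF that])
    qed
  qed
  then have "0 < n * 2 \<and> (g \<circ> sigma V) ^^ (n * 2) = id"
    using n by (auto simp: twist_def)
  then have "0 < T \<and> (g \<circ> sigma V) ^^ T = id"
    unfolding twist_order_def map_order_def by (rule LeastI)
  then show "0 < T" "twist ^^ T = id"
    by (simp_all add: twist_def)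
qed

section \<open>Roots of unity and the eigenspace decomposition\<close>

definition twist_root :: "nat \<Rightarrow> complex" where
  "twist_root r = exp (2 * of_real pi * \<i> * of_nat r / of_nat T)"

lemma mem_twist_eigenspace: "v \<in> E r \<longleftrightarrow> twist v = vscale V (twist_root r) v"
  by (simp add: twist_eigenspace_def twist_def twist_root_def)

lemma twist_root_add: "twist_root (r + s) = twist_root r * twist_root s"
  by (simp add: twist_root_def exp_add[symmetric] add_divide_distrib distrib_left)

lemma twist_root_0 [simp]: "twist_root 0 = 1"
  by (simp add: twist_root_def)

lemma twist_root_power: "twist_root r ^ j = twist_root (r * j)"
  by (induction j) (simp_all add: twist_root_add)

lemma twist_root_T [simp]: "twist_root (T * j) = 1"
  unfolding twist_root_power[symmetric] using twist_order_properties
  by (simp add: twist_root_def exp_eq_polar[of "2 * of_real pi * \<i>"])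

lemma twist_root_mod: "twist_root (r mod T) = twist_root r"
  using twist_root_add[of "T * (r div T)" "r mod T"] by simp

lemma twist_root_eq_1_iff: "r < T \<Longrightarrow> twist_root r = 1 \<longleftrightarrow> r = 0"
proof -
  assume r: "r < T"
  have cis: "twist_root r = cis (2 * pi * real r / real T)" for r
    by (simp add: twist_root_def cis_conv_exp mult_ac)
  have "inj_on (\<lambda>k. cis (2 * pi * real k / real T)) {..<T}"
    using bij_betw_roots_unity[OF twist_order_properties(1)] by (rule bij_betw_imp_inj_on)
  from inj_onD[OF this, of r 0] r twist_order_properties show ?thesis
    by (auto simp: cis[symmetric])
qed

lemma twist_root_nonzero [simp]: "twist_root r \<noteq> 0"
  by (simp add: twist_root_def)

lemma subspace_eigenspace: "subspace (E r)"
  by (intro subspaceI)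
    (simp_all add: mem_twist_eigenspace module_hom.zero[OF module_hom_twist]
      module_hom.add[OF module_hom_twist] module_hom.scale[OF module_hom_twist]
      scale_right_distrib mult.commute)

text \<open>The twist respects modes: \<open>g\<close> does, and the parity of \<open>u_n v\<close>
  is the sum of the parities of \<open>u\<close> and \<open>v\<close>, since its doubled weight
  differs from \<open>k + l\<close> by an even number. Hence the eigenvalues multiply.\<close>

lemma mode_eigenspace:
  assumes "u \<in> vgrade V k \<inter> E r" "v \<in> vgrade V l \<inter> E s"
  shows "vmode V u n v \<in> E ((r + s) mod T)"
\<comment> \<open>A negative doubled weight is treated apart: there \<open>nat\<close> would falsify
  the parity, but the mode vanishes.\<close>
proof (cases "int k + int l - 2 * n - 2 < 0")
  case True
  then show ?thesis
    using assms subspace_0[OF subspace_eigenspace] by (simp add: mode_eq_0[of u k v l])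
next
  case False
  have par: "even (k + l) \<longleftrightarrow> even (nat (int k + int l - 2 * n - 2))"
    using False by (simp add: even_nat_iff)
  then have sgn: "(- 1 :: complex) ^ nat (int k + int l - 2 * n - 2) = (- 1) ^ k * (- 1) ^ l"
    unfolding power_add[symmetric] by (simp only: minus_one_power_iff par)
  have "twist (vmode V u n v) = vscale V ((- 1) ^ k * (- 1) ^ l) (vmode V (g u) n (g v))"
    using assms twist_of_grade[OF mode_grade, of u k v l n] by (simp add: sgn g_mode)
  also have "\<dots> = vmode V (twist u) n (twist v)"
    using assms by (simp add: twist_of_grade[of u k] twist_of_grade[of v l] mode_scale mult.commute)
  also have "\<dots> = vscale V (twist_root (r + s)) (vmode V u n v)"
    using assms by (simp add: mem_twist_eigenspace mode_scale twist_root_add mult.commute)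
  finally show ?thesis
    by (simp add: mem_twist_eigenspace twist_root_mod)
qed

text \<open>The average over the cyclic group generated by the twist, weighted with the inverse
  character of index \<open>r\<close>.\<close>

definition eigenprojection :: "nat \<Rightarrow> 'v \<Rightarrow> 'v" where
  "eigenprojection r v =
    vscale V (1 / of_nat T) (\<Sum>j<T. vscale V (inverse (twist_root (r * j))) ((twist ^^ j) v))"

lemma module_hom_eigenprojection: "module_hom (vscale V) (vscale V) (eigenprojection r)"
  unfolding module_hom_iff eigenprojection_def
  by (simp add: module_axioms module_hom.add[OF module_hom_funpow[OF module_hom_twist]]
      module_hom.scale[OF module_hom_funpow[OF module_hom_twist]]
      scale_right_distrib sum.distrib scale_sum_right mult_ac)

lemma eigenprojection_grade: "v \<in> vgrade V k \<Longrightarrow> eigenprojection r v \<in> vgrade V k"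
proof -
  assume v: "v \<in> vgrade V k"
  have "(twist ^^ j) v \<in> vgrade V k" for j
    by (induction j) (simp_all add: v twist_grade)
  then show ?thesis
    unfolding eigenprojection_def
    by (intro subspace_scale[OF grade_subspace] subspace_sum[OF grade_subspace])
qed

lemma eigenprojection_eigenspace: "eigenprojection r v \<in> E r"
proof -
  define f where "f j = vscale V (inverse (twist_root (r * j))) ((twist ^^ j) v)" for j
  \<comment> \<open>Periodicity: applying the twist shifts the summation index by one, which does
    not change the sum over a full period.\<close>
  have "f T = f 0"
    by (simp add: f_def twist_order_properties mult.commute[of r])
  then have shift: "(\<Sum>j<T. f (Suc j)) = (\<Sum>j<T. f j)"
    using sum.lessThan_Suc_shift[of f T] sum.lessThan_Suc[of f T] by simp
  have step: "twist (f j) = vscale V (twist_root r) (f (Suc j))" for j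
    by (simp add: f_def module_hom.scale[OF module_hom_twist] twist_root_add)
  have "twist (eigenprojection r v) = vscale V (1 / of_nat T) (\<Sum>j<T. twist (f j))"
    by (simp add: eigenprojection_def f_def module_hom.scale[OF module_hom_twist]
        module_hom.sum[OF module_hom_twist])
  also have "\<dots> = vscale V (twist_root r) (vscale V (1 / of_nat T) (\<Sum>j<T. f (Suc j)))"
    by (simp add: step scale_sum_right mult.commute)
  also have "\<dots> = vscale V (twist_root r) (eigenprojection r v)"
    unfolding shift by (simp add: eigenprojection_def f_def)
  finally show ?thesis
    by (simp add: mem_twist_eigenspace)
qed

lemma sum_powers_twist_root:
  assumes "r < T"
  shows "(\<Sum>j<T. twist_root (r * j)) = (if r = 0 then of_nat T else 0)"
proof (cases "r = 0")
  case False
  then have "twist_root r \<noteq> 1" using assms by (simp add: twist_root_eq_1_iff)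
  moreover have "twist_root r ^ T = 1"
    by (simp add: twist_root_power mult.commute[of r])
  ultimately show ?thesis
    using False geometric_sum[of "twist_root r" T] by (simp add: twist_root_power)
qed simp

lemma sum_eigenprojection: "(\<Sum>r<T. eigenprojection r v) = v"
proof -
  have inv: "(\<Sum>r<T. inverse (twist_root (r * j))) = (if j = 0 then of_nat T else 0)" if "j < T" for j
  proof (cases "j = 0")
    case False
    \<comment> \<open>Rewriting the inverse as a root with index \<open>(T - j) * r\<close> makes
      the sum over \<open>r\<close> a sum of powers of a nontrivial root of unity.\<close>
    have "inverse (twist_root (r * j)) = twist_root ((T - j) * r)" for r
    proof -
      have "r * j + (T - j) * r = T * r"
        using that by (simp add: algebra_simps flip: distrib_left add_mult_distrib2)
      then have "twist_root (r * j) * twist_root ((T - j) * r) = 1"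
        by (simp add: twist_root_add[symmetric])
      then show ?thesis by (rule inverse_unique)
    qed
    then show ?thesis
      using False that sum_powers_twist_root[of "T - j"] by simp
  qed simp
  have "(\<Sum>r<T. eigenprojection r v) = vscale V (1 / of_nat T)
      (\<Sum>j<T. vscale V (\<Sum>r<T. inverse (twist_root (r * j))) ((twist ^^ j) v))"
    unfolding eigenprojection_def scale_sum_right[symmetric] scale_sum_left
    by (subst sum.swap) (rule refl)
  also have "\<dots> = vscale V (1 / of_nat T) (\<Sum>j<T. if j = 0 then vscale V (of_nat T) v else 0)"
    by (intro arg_cong[where f = "vscale V _"] sum.cong) (auto simp: inv)
  also have "\<dots> = v"
    using twist_order_properties by (simp add: sum.delta)
  finally show ?thesis .
qed

lemma eigenprojection_0:
  assumes "r < T" "v \<in> E r"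
  shows "eigenprojection 0 v = (if r = 0 then v else 0)"
proof -
  have "(twist ^^ j) v = vscale V (twist_root (r * j)) v" for j
    using assms(2)
    by (induction j)
      (simp_all add: mem_twist_eigenspace module_hom.scale[OF module_hom_twist] twist_root_add mult.commute)
  then have "eigenprojection 0 v = vscale V (1 / of_nat T) (vscale V (\<Sum>j<T. twist_root (r * j)) v)"
    by (simp add: eigenprojection_def scale_sum_left)
  with assms(1) show ?thesis
    by (auto simp: sum_powers_twist_root)
qed

text \<open>Eigenprojections preserve weights, so the vectors homogeneous for both the weight and
  the twist span \<open>V\<close>.\<close>

lemma homogeneous_induct:
  assumes "subspace S" "\<And>k r v. r < T \<Longrightarrow> v \<in> vgrade V k \<inter> E r \<Longrightarrow> v \<in> S"
  shows "v \<in> S"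
proof -
  have "component v k \<in> S" for k
  proof -
    have "(\<Sum>r<T. eigenprojection r (component v k)) \<in> S"
      by (intro subspace_sum assms(1) assms(2)[where k = k])
        (auto simp: eigenprojection_grade component_grade eigenprojection_eigenspace)
    then show ?thesis
      by (simp add: sum_eigenprojection)
  qed
  then have "(\<Sum>k | component v k \<noteq> 0. component v k) \<in> S"
    by (intro subspace_sum assms(1))
  then show ?thesis
    by (simp add: component_eq_sum[symmetric])
qed

lemma subspace_hom_eq:
  assumes "module_hom (vscale V) (vscale V) h" "module_hom (vscale V) (vscale V) h'"
  shows "subspace {v. h v = h' v}"
  by (rule subspaceI)
    (simp_all add: module_hom.zero[OF assms(1)] module_hom.zero[OF assms(2)]
      module_hom.add[OF assms(1)] module_hom.add[OF assms(2)]
      module_hom.scale[OF assms(1)] module_hom.scale[OF assms(2)])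

text \<open>The definite description needs existence and uniqueness. The former holds by projecting
  \<open>u\<close> to weight \<open>k\<close> and twist eigenvalue 1 before taking the residue, the
  latter because the homogeneous vectors span.\<close>

lemma zhu_star_properties:
  "(\<forall>u. vlinear V (zhu_star V g u)) \<and> (\<forall>v. vlinear V (\<lambda>u. zhu_star V g u v)) \<and>
   (\<forall>r k u v. r < T \<longrightarrow> u \<in> vgrade V k \<inter> E r \<longrightarrow>
      zhu_star V g u v = (if r = 0 then residue_product V (weight k) 1 u v else 0))"
  (is "?P (zhu_star V g)")
proof -
  define m where "m u v = Sum_any (\<lambda>k. residue (binomial_fls (weight k) (- 1))
      (eigenprojection 0 (component u k)) v)" for u v
  have zero: "eigenprojection r 0 = 0" for r
    by (rule module_hom.zero[OF module_hom_eigenprojection])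
  have fin: "finite {k. residue (binomial_fls (weight k) (- 1))
      (eigenprojection 0 (component u k)) v \<noteq> 0}" for u v
    by (rule finite_subset[OF _ finite_component[of u]]) (auto simp: zero)
  have "?P m"
  proof (intro conjI allI impI)
    fix u v
    show "vlinear V (m u)"
      unfolding Vector_Spaces.linear_iff
    proof (intro conjI allI vector_space_axioms)
      show "m u (x + y) = m u x + m u y" for x y
        unfolding m_def residue_add by (rule Sum_any.distrib[OF fin fin])
      show "m u (vscale V c x) = vscale V c (m u x)" for c x
        unfolding m_def residue_scale by (rule Sum_any_hom[OF module_hom_scale fin, symmetric])
    qed
    show "vlinear V (\<lambda>u. m u v)"
      unfolding Vector_Spaces.linear_iff
    proof (intro conjI allI vector_space_axioms)
      show "m (x + y) v = m x v + m y v" for x y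
        unfolding m_def component_add module_hom.add[OF module_hom_eigenprojection] residue_add
        by (rule Sum_any.distrib[OF fin fin])
      show "m (vscale V c x) v = vscale V c (m x v)" for c x
        unfolding m_def component_scale module_hom.scale[OF module_hom_eigenprojection] residue_scale
        by (rule Sum_any_hom[OF module_hom_scale fin, symmetric])
    qed
    fix r k
    assume r: "r < T" and u: "u \<in> vgrade V k \<inter> E r"
    have "m u v = residue (binomial_fls (weight k) (- 1)) (eigenprojection 0 u) v"
      unfolding m_def using u
      by (subst Sum_any.expand_superset[of "{k}"]) (auto simp: component_of_grade zero split: if_splits)
    then show "m u v = (if r = 0 then residue_product V (weight k) 1 u v else 0)"
      using r u by (simp add: eigenprojection_0[of r] residue_product_eq_residue)
  qed
  moreover have "m' = m" if m': "?P m'" for m'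
  proof (intro ext)
    fix u v
    have "u \<in> {u. m' u v = m u v}"
    proof (rule homogeneous_induct)
      show "subspace {u. m' u v = m u v}"
        using m' \<open>?P m\<close> by (intro subspace_hom_eq) (simp_all add: module_hom_iff_linear)
      show "u \<in> {u. m' u v = m u v}" if "r < T" "u \<in> vgrade V k \<inter> E r" for k r u
      proof -
        have "m' u v = (if r = 0 then residue_product V (weight k) 1 u v else 0)"
          "m u v = (if r = 0 then residue_product V (weight k) 1 u v else 0)"
          using m' \<open>?P m\<close> that by blast+
        then show ?thesis by simp
      qed
    qed
    then show "m' u v = m u v" by simp
  qed
  ultimately show ?thesis
    unfolding zhu_star_def by (rule theI2)
qed

abbreviation star :: "'v \<Rightarrow> 'v \<Rightarrow> 'v" (infixl "\<star>" 70) where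
  "u \<star> v \<equiv> zhu_star V g u v"

lemma module_hom_star:
  "module_hom (vscale V) (vscale V) ((\<star>) u)" "module_hom (vscale V) (vscale V) (\<lambda>u. u \<star> v)"
  using zhu_star_properties by (auto simp: module_hom_iff_linear)

lemmas star_add = module_hom_star[THEN module_hom.add]
lemmas star_scale = module_hom_star[THEN module_hom.scale]
lemmas star_zero [simp] = module_hom_star[THEN module_hom.zero]
lemmas star_diff = module_hom_star[THEN module_hom.diff]
lemmas star_sum = module_hom_star[THEN module_hom.sum]

lemma star_eq_residue:
  "u \<in> vgrade V k \<Longrightarrow> u \<in> E 0 \<Longrightarrow> u \<star> v = residue (binomial_fls (weight k) (- 1)) u v"
  using zhu_star_properties twist_order_properties by (auto simp: residue_product_eq_residue)

lemma star_eq_0: "u \<in> vgrade V k \<Longrightarrow> u \<in> E r \<Longrightarrow> 0 < r \<Longrightarrow> r < T \<Longrightarrow> u \<star> v = 0"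
  using zhu_star_properties by auto

section \<open>The ideal and the product\<close>

lemma subspace_O: "subspace (zhu_O V g)"
  unfolding zhu_O_def by (rule subspace_span)

lemma O_closed:
  "x \<in> zhu_O V g \<Longrightarrow> y \<in> zhu_O V g \<Longrightarrow> x + y \<in> zhu_O V g"
  "x \<in> zhu_O V g \<Longrightarrow> y \<in> zhu_O V g \<Longrightarrow> x - y \<in> zhu_O V g"
  "x \<in> zhu_O V g \<Longrightarrow> vscale V c x \<in> zhu_O V g"
  "x \<in> zhu_O V g \<Longrightarrow> - x \<in> zhu_O V g"
  "0 \<in> zhu_O V g"
  by (simp_all add: subspace_add[OF subspace_O] subspace_diff[OF subspace_O]
      subspace_scale[OF subspace_O] subspace_neg[OF subspace_O] subspace_0[OF subspace_O])

lemma O_minusD: "- x \<in> zhu_O V g \<Longrightarrow> x \<in> zhu_O V g"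
  using O_closed(4)[of "- x"] by simp

lemma conf_eigenspace: "vconf V \<in> E 0"
  by (simp add: mem_twist_eigenspace twist_of_grade[OF conf_grade])

lemma vac_eigenspace: "vvac V \<in> E 0"
  by (simp add: mem_twist_eigenspace twist_of_grade[OF vac_grade])

definition delta :: "nat \<Rightarrow> nat" where
  "delta r = (if r = 0 then 1 else 0)"

definition circ_exponent :: "nat \<Rightarrow> nat \<Rightarrow> complex" where
  "circ_exponent k r = weight k - 1 + of_nat (delta r) + of_nat r / of_nat T"

lemma zhu_circ_eq_residue:
  "zhu_circ V g r k u v = residue (binomial_fls (circ_exponent k r) (- 1 - int (delta r))) u v"
  by (simp add: zhu_circ_def Let_def residue_product_eq_residue circ_exponent_def delta_def)

text \<open>
  Zhu's induction: passing from \<open>u\<close> to \<open>L(-1)u\<close> raises the weight by one and, by partial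
  integration, the order of the pole.
\<close>

lemma residue_mem_O_pole:
  assumes "r < T" "u \<in> vgrade V k \<inter> E r"
  shows "residue (binomial_fls (circ_exponent k r) (- 1 - int (delta r) - int m)) u v \<in> zhu_O V g"
  using assms(2)
proof (induction m arbitrary: k u)
  case 0
  then have "zhu_circ V g r k u v \<in> zhu_O V g"
    unfolding zhu_O_def using assms(1) by (intro span_base) blast
  then show ?case by (simp add: zhu_circ_eq_residue)
next
  case (Suc m)
  let ?\<beta> = "circ_exponent k r" and ?p = "- 1 - int (delta r) - int m"
  \<comment> \<open>Indices are doubled weights, so raising the weight by one means
    \<open>k + 2\<close>; \<open>r\<close> is kept because the conformal vector is fixed by the
    twist.\<close>
  have Lu: "virL V (- 1) u \<in> vgrade V (k + 2) \<inter> E r"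
    using mode_grade[OF conf_grade, of u k 0] mode_eigenspace[of "vconf V" 4 0 u k r 0]
      Suc.prems conf_grade conf_eigenspace assms(1)
    by (simp add: virL_def nat_add_distrib add.commute[of _ "int k"])
  have "circ_exponent (k + 2) r = ?\<beta> + 1"
    by (simp add: circ_exponent_def weight_def add_divide_distrib)
  then have "residue (binomial_fls (?\<beta> + 1) ?p) (virL V (- 1) u) v \<in> zhu_O V g"
    using Suc.IH[OF Lu] by simp
  also have "residue (binomial_fls (?\<beta> + 1) ?p) (virL V (- 1) u) v =
      - (vscale V (?\<beta> + 1) (residue (binomial_fls ?\<beta> ?p) u v) +
         vscale V (of_int ?p) (residue (binomial_fls ?\<beta> (?p - 1)) u v +
           residue (binomial_fls ?\<beta> ?p) u v))"
    unfolding residue_translation fls_deriv_binomial_fls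
    by (simp only: residue_add_series residue_scale_series binomial_fls_add_one
        add_diff_cancel_right' diff_add_cancel)
  finally have sum: "vscale V (?\<beta> + 1) (residue (binomial_fls ?\<beta> ?p) u v) +
         vscale V (of_int ?p) (residue (binomial_fls ?\<beta> (?p - 1)) u v +
           residue (binomial_fls ?\<beta> ?p) u v) \<in> zhu_O V g" (is "?x + vscale V _ (?y + ?z) \<in> _")
    by (rule O_minusD)
  \<comment> \<open>The terms \<open>?x\<close> and \<open>?z\<close> have the pole order of the
    induction hypothesis. Only \<open>?y\<close> has the new pole, with coefficient
    \<open>?p\<close>, which is at most \<open>- 1\<close> and can be divided out.\<close>
  have z: "?z \<in> zhu_O V g" by (rule Suc.IH[OF Suc.prems])
  then have "?x \<in> zhu_O V g" by (rule O_closed)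
  from O_closed(2)[OF sum this] have "vscale V (of_int ?p) (?y + ?z) \<in> zhu_O V g" by simp
  from O_closed(3)[OF this, of "1 / of_int ?p"] have "?y + ?z \<in> zhu_O V g"
  proof -
    have "(of_int ?p :: complex) \<noteq> 0" unfolding of_int_eq_0_iff by simp
    then have "vscale V (1 / of_int ?p) (vscale V (of_int ?p) (?y + ?z)) = ?y + ?z"
      by (simp del: of_int_diff of_int_minus)
    with \<open>vscale V (1 / of_int ?p) (vscale V (of_int ?p) (?y + ?z)) \<in> zhu_O V g\<close>
    show ?thesis by simp
  qed
  from O_closed(2)[OF this z] show ?case by (simp add: diff_diff_eq add.commute)
qed

text \<open>By \<open>binomial_fls_add_one\<close>, one more factor \<open>1 + z\<close> gives the
  terms with the same and with the next lower pole order; both stay in range since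
  \<open>n < m\<close> before the factor is added.\<close>

lemma residue_mem_O:
  assumes "r < T" "u \<in> vgrade V k \<inter> E r" "n \<le> m"
  shows "residue (binomial_fls (circ_exponent k r + of_nat n) (- 1 - int (delta r) - int m)) u v
    \<in> zhu_O V g"
  using assms(3)
proof (induction n arbitrary: m)
  case 0
  show ?case using residue_mem_O_pole[OF assms(1,2)] by simp
next
  case (Suc n)
  then obtain m' where m': "m = Suc m'" "n \<le> m'" by (cases m) auto
  have "residue (binomial_fls (circ_exponent k r + of_nat n) (- 1 - int (delta r) - int m)) u v +
      residue (binomial_fls (circ_exponent k r + of_nat n) (- 1 - int (delta r) - int m')) u v
      \<in> zhu_O V g"
    using Suc.IH[of m] Suc.IH[of m'] m' by (intro O_closed) auto
  also have "residue (binomial_fls (circ_exponent k r + of_nat n) (- 1 - int (delta r) - int m)) u v +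
      residue (binomial_fls (circ_exponent k r + of_nat n) (- 1 - int (delta r) - int m')) u v =
      residue (binomial_fls (circ_exponent k r + of_nat n + 1) (- 1 - int (delta r) - int m)) u v"
  proof -
    have "- 1 - int (delta r) - int m + 1 = - 1 - int (delta r) - int m'"
      by (simp add: m')
    then show ?thesis
      by (simp only: binomial_fls_add_one residue_add_series)
  qed
  finally show ?case by (simp add: add_ac)
qed

lemma residue_mem_O':
  assumes "r < T" "u \<in> vgrade V k \<inter> E r" "n \<le> m"
    "\<alpha> = circ_exponent k r + of_nat n" "p = - 1 - int (delta r) - int m"
  shows "residue (binomial_fls \<alpha> p) u v \<in> zhu_O V g"
  using residue_mem_O[OF assms(1-3)] assms(4,5) by simp

text \<open>The generators of \<open>zhu_O\<close> admit any second argument, while the Borcherds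
  identity requires homogeneous states. Linearity in that argument closes the gap.\<close>

lemma O_induct:
  assumes "module_hom (vscale V) (vscale V) h" "x \<in> zhu_O V g"
    "\<And>r k s l u v. r < T \<Longrightarrow> u \<in> vgrade V k \<inter> E r \<Longrightarrow> s < T \<Longrightarrow> v \<in> vgrade V l \<inter> E s \<Longrightarrow>
      h (zhu_circ V g r k u v) \<in> zhu_O V g"
  shows "h x \<in> zhu_O V g"
proof -
  have sub: "subspace {x. f x \<in> zhu_O V g}" if "module_hom (vscale V) (vscale V) f" for f
    by (rule subspaceI)
      (simp_all add: module_hom.zero[OF that] module_hom.add[OF that] module_hom.scale[OF that] O_closed)
  have "h (zhu_circ V g r k u v) \<in> zhu_O V g" if "r < T" "u \<in> vgrade V k \<inter> E r" for r k u v
  proof -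
    have "v \<in> {v. h (zhu_circ V g r k u v) \<in> zhu_O V g}"
    proof (rule homogeneous_induct)
      show "subspace {v. h (zhu_circ V g r k u v) \<in> zhu_O V g}"
        unfolding zhu_circ_eq_residue
        by (rule sub[OF module_hom_compose[OF module_hom_residue(1) assms(1), unfolded o_def]])
    qed (use that assms(3) in blast)
    then show ?thesis by simp
  qed
  then have "zhu_O V g \<subseteq> {x. h x \<in> zhu_O V g}"
    unfolding zhu_O_def[of V g]
    by (intro span_minimal sub[unfolded zhu_O_def[of V g]] assms(1)) (auto simp: zhu_O_def)
  with assms(2) show ?thesis by blast
qed

lemma weight_mode_nat:
  assumes "0 \<le> int k + int l - 2 * n - 2"
  shows "weight (nat (int k + int l - 2 * n - 2)) = weight k + weight l - of_int n - 1"
  using assms by (simp add: weight_nat) (simp add: weight_def field_simps)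

text \<open>Commuting \<open>u_f\<close> past \<open>v_h\<close> gives \<open>v_h\<close> applied to
  another vector, which is a circle product, and residues of the vectors \<open>u_i v\<close>, which
  stay in the eigenspace of \<open>v\<close>.\<close>

lemma star_O_homogeneous:
  assumes u: "u \<in> vgrade V k \<inter> E 0" and r: "r < T" and v: "v \<in> vgrade V l \<inter> E r"
  shows "u \<star> zhu_circ V g r l v w \<in> zhu_O V g"
proof -
  let ?f = "binomial_fls (weight k) (- 1)"
    and ?h = "binomial_fls (circ_exponent l r) (- 1 - int (delta r))"
  have uv: "u \<in> vgrade V k" "v \<in> vgrade V l" using u v by auto
  have terms: "residue (hasse_deriv i ?f * ?h) (vmode V u (int i) v) w \<in> zhu_O V g" for i
  proof (cases "0 \<le> int k + int l - 2 * int i - 2")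
    case True
    let ?j = "nat (int k + int l - 2 * int i - 2)"
    have x: "vmode V u (int i) v \<in> vgrade V ?j \<inter> E r"
      using mode_grade[OF uv, of "int i"] mode_eigenspace[OF u v, of "int i"] r by simp
    show ?thesis
    proof (rule hasse_deriv_binomial_fls_induct[of "\<lambda>f. residue (f * ?h) (vmode V u (int i) v) w \<in> zhu_O V g"])
      fix j assume "j \<le> i"
      show "residue (binomial_fls (weight k - of_nat i + of_nat j) (- 1 - int j) * ?h)
          (vmode V u (int i) v) w \<in> zhu_O V g"
        unfolding binomial_fls_mult
        \<comment> \<open>Relative to the circle product for \<open>u_i v\<close>, the Leibniz term
          \<open>j\<close> has exactly \<open>j + 1\<close> additional factors \<open>1 + z\<close>
          and \<open>j + 1\<close> additional poles.\<close>
        by (rule residue_mem_O'[OF r x, of "Suc j" "Suc j"])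
          (simp_all add: circ_exponent_def weight_mode_nat[OF True])
    qed (simp_all add: distrib_right residue_add_series mult.assoc residue_scale_series O_closed)
  qed (simp add: mode_eq_0[OF uv] O_closed)
  have "\<forall>\<^sub>F N in sequentially. residue ?f u (residue ?h v w) \<in> zhu_O V g"
    using commutator[OF uv, of ?f ?h w]
  proof eventually_elim
    case (elim N)
    have "(\<Sum>i<N. residue (hasse_deriv i ?f * ?h) (vmode V u (int i) v) w) \<in> zhu_O V g"
      by (intro subspace_sum[OF subspace_O] terms)
    moreover have "residue ?h v (residue ?f u w) \<in> zhu_O V g"
      by (rule residue_mem_O'[OF r v, of 0 0]) simp_all
    ultimately have "(\<Sum>i<N. residue (hasse_deriv i ?f * ?h) (vmode V u (int i) v) w) +
        vscale V ((- 1) ^ (k * l)) (residue ?h v (residue ?f u w)) \<in> zhu_O V g"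
      by (intro O_closed)
    then show ?case
      by (simp add: elim)
  qed
  then show ?thesis
    using u by (simp add: zhu_circ_eq_residue star_eq_residue[of u k])
qed

lemma star_O:
  assumes "x \<in> zhu_O V g"
  shows "u \<star> x \<in> zhu_O V g"
proof -
  have "u \<in> {u. u \<star> x \<in> zhu_O V g}"
  proof (rule homogeneous_induct)
    show "subspace {u. u \<star> x \<in> zhu_O V g}"
      by (rule subspaceI) (simp_all add: star_add star_scale O_closed)
    fix k r u assume u: "r < T" "u \<in> vgrade V k \<inter> E r"
    show "u \<in> {u. u \<star> x \<in> zhu_O V g}"
    proof (cases "r = 0")
      case True
      with u have "u \<star> x \<in> zhu_O V g"
        by (intro O_induct[OF module_hom_star(1) assms] star_O_homogeneous) auto
      then show ?thesis by simp
    next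
      case False
      with u show ?thesis by (simp add: star_eq_0[of u k r] O_closed)
    qed
  qed
  then show ?thesis by simp
qed

lemma residue_star_eq_0:
  assumes "u \<in> vgrade V k \<inter> E r" "v \<in> vgrade V l \<inter> E s" "(r + s) mod T \<noteq> 0"
  shows "residue f u v \<star> w = 0"
proof -
  have "residue f u v \<in> {x. x \<star> w = 0}"
  proof (rule residue_mem_subspace)
    show "subspace {x. x \<star> w = 0}"
      by (rule subspaceI) (simp_all add: star_add star_scale)
    fix n
    have "vmode V u n v \<star> w = 0"
      by (rule star_eq_0[OF mode_grade mode_eigenspace[OF assms(1,2)]])
        (use assms twist_order_properties in auto)
    then show "vmode V u n v \<in> {x. x \<star> w = 0}" by simp
  qed
  then show ?thesis by simp
qed

text \<open>
  The modes of \<open>u\<close> in \<open>residue f u v\<close> produce vectors of different weights, each of which is multiplied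
  with its own power of \<open>1 + z\<close>. These powers are exactly those in the Taylor expansion of
  \<open>(1 + z\<^sub>2 + z\<^sub>0)\<^sup>\<alpha> (1 + z\<^sub>2)\<^sup>\<beta>\<close>, which fixes \<open>\<beta>\<close> and brings in the Borcherds identity.
\<close>

lemma residue_star:
  assumes u: "u \<in> vgrade V k \<inter> E r" and v: "v \<in> vgrade V l \<inter> E s" and rs: "(r + s) mod T = 0"
    and \<beta>: "\<beta> = weight k + weight l + of_nat d - 1 - \<alpha>"
  shows "\<forall>\<^sub>F N in sequentially. residue (binomial_fls \<alpha> (- int d)) u v \<star> w =
    (\<Sum>i<N. vscale V ((- 1) ^ i * (of_int (- int d) gchoose i))
      (residue (binomial_fls \<alpha> (- int d - int i)) u (residue (binomial_fls \<beta> (int i - 1)) v w) -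
       vscale V ((- 1) ^ (k * l) * (- 1) powi (- int d))
        (residue (binomial_fls \<beta> (- 1 - int d - int i)) v (residue (binomial_fls \<alpha> (int i)) u w))))"
proof -
  have uv: "u \<in> vgrade V k" "v \<in> vgrade V l" using u v by auto
  have *: "vscale V (\<alpha> gchoose i) (vmode V u (- int d + int i) v \<star> w) =
      residue (hasse_deriv i (binomial_fls \<alpha> 0) * binomial_fls \<beta> (- 1)) (vmode V u (- int d + int i) v) w"
    for i
  proof (cases "0 \<le> int k + int l - 2 * (- int d + int i) - 2")
    case True
    have "weight (nat (int k + int l - 2 * (- int d + int i) - 2)) = \<alpha> - of_nat i + \<beta>"
      unfolding weight_mode_nat[OF True] \<beta> by simp
    moreover have "vmode V u (- int d + int i) v \<in> E 0"
      using mode_eigenspace[OF u v, of "- int d + int i"] rs by simp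
    ultimately show ?thesis
      by (simp add: star_eq_residue[OF mode_grade[OF uv]] hasse_deriv_binomial_fls mult.assoc
          binomial_fls_mult residue_scale_series)
  qed (simp add: mode_eq_0[OF uv])
  show ?thesis
    using borcherds[OF uv, of "- int d" w "binomial_fls \<alpha> 0" "binomial_fls \<beta> (- 1)",
        unfolded borcherds_series_def]
      eventually_residue_binomial_fls[of \<alpha> d u v]
  proof eventually_elim
    case (elim N)
    show ?case
      unfolding elim(2) star_sum star_scale * elim(1) binomial_fls_mult
      by (simp add: algebra_simps)
  qed
qed

text \<open>If \<open>r + s\<close> is not divisible by \<open>T\<close>, the product vanishes.
  Otherwise the exponent \<open>\<beta>\<close> in \<open>residue_star\<close> is that of the circle
  product for \<open>v\<close> plus one, and every term on the right is an admissible residue for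
  \<open>u\<close> or for \<open>v\<close>.\<close>

lemma O_star_homogeneous:
  assumes r: "r < T" and u: "u \<in> vgrade V k \<inter> E r" and s: "s < T" and v: "v \<in> vgrade V l \<inter> E s"
  shows "zhu_circ V g r k u v \<star> w \<in> zhu_O V g"
proof (cases "(r + s) mod T = 0")
  case False
  then show ?thesis
    by (simp add: zhu_circ_eq_residue residue_star_eq_0[OF u v] O_closed)
next
  case True
  let ?\<alpha> = "circ_exponent k r" and ?\<beta> = "circ_exponent l s + 1" and ?d = "1 + delta r"
  have "r + s = 0 \<or> r + s = T"
  proof -
    obtain q where q: "r + s = T * q" using True by (auto elim: dvdE simp: dvd_eq_mod_eq_0[symmetric])
    then have "T * q < T * 2" using r s by linarith
    then have "q < 2" by (metis mult_less_cancel1)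
    then show ?thesis using q by (auto simp: less_2_cases_iff)
  qed
  \<comment> \<open>Either \<open>r = s = 0\<close>, or \<open>r + s = T\<close> with both positive;
    this is what makes the two exponents complementary.\<close>
  then have s_eq: "delta s = delta r" "(of_nat r + of_nat s) / of_nat T = 1 - (of_nat (delta r) :: complex)"
    using r s twist_order_properties
    by (auto simp: delta_def of_nat_add[symmetric] simp del: of_nat_add)
  have \<beta>: "?\<beta> = weight k + weight l + of_nat ?d - 1 - ?\<alpha>"
    using s_eq(2) by (simp add: circ_exponent_def s_eq(1) add_divide_distrib algebra_simps)
  have "\<forall>\<^sub>F N in sequentially. zhu_circ V g r k u v \<star> w \<in> zhu_O V g"
    using residue_star[OF u v True \<beta>, of w]
  proof eventually_elim
    case (elim N)
    have 1: "residue (binomial_fls ?\<alpha> (- int ?d - int i)) u x \<in> zhu_O V g" for i x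
      by (rule residue_mem_O'[OF r u, of 0 i]) simp_all
    have 2: "residue (binomial_fls ?\<beta> (- 1 - int ?d - int i)) v x \<in> zhu_O V g" for i x
      \<comment> \<open>The one additional factor \<open>1 + z\<close> is covered by the
        \<open>i + 1\<close> additional poles.\<close>
      by (rule residue_mem_O'[OF s v, of 1 "Suc i"]) (simp_all add: s_eq)
    have "zhu_circ V g r k u v = residue (binomial_fls ?\<alpha> (- int ?d)) u v"
      by (simp add: zhu_circ_eq_residue)
    then show ?case
      by (simp only: elim) (intro subspace_sum[OF subspace_O] O_closed 1 2)
  qed
  then show ?thesis by simp
qed

lemma O_star:
  assumes "x \<in> zhu_O V g"
  shows "x \<star> w \<in> zhu_O V g"
  by (rule O_induct[OF module_hom_star(2) assms O_star_homogeneous])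

text \<open>For \<open>d = 1\<close> and \<open>\<alpha> = weight k\<close>, \<open>\<beta>\<close>
  is \<open>weight l\<close>. The summand \<open>i = 0\<close> of \<open>residue_star\<close>
  contains the iterated product, and all other residues have an outer pole of order at least two, as
  in the circle product for \<open>r = 0\<close>.\<close>

lemma star_assoc_homogeneous:
  assumes u: "u \<in> vgrade V k \<inter> E 0" and v: "v \<in> vgrade V l \<inter> E 0"
  shows "u \<star> v \<star> w - u \<star> (v \<star> w) \<in> zhu_O V g"
proof -
  have T: "0 < T" by (rule twist_order_properties)
  have ex: "circ_exponent j 0 = weight j" for j
    by (simp add: circ_exponent_def delta_def)
  have star_hyps: "(0 + 0) mod T = 0" "weight l = weight k + weight l + of_nat 1 - 1 - weight k"
    by simp_all
  let ?f = "binomial_fls (weight k)" and ?h = "binomial_fls (weight l)"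
  let ?\<epsilon> = "(- 1) ^ (k * l) * (- 1) powi (- int 1) :: complex"
  define t where "t i = vscale V ((- 1) ^ i * (of_int (- int 1) gchoose i))
      (residue (?f (- int 1 - int i)) u (residue (?h (int i - 1)) v w) -
       vscale V ?\<epsilon> (residue (?h (- 1 - int 1 - int i)) v (residue (?f (int i)) u w)))" for i
  have 1: "residue (?f (- int 1 - int (Suc i))) u x \<in> zhu_O V g" for i x
    by (rule residue_mem_O'[OF T u, of 0 i]) (simp_all add: ex delta_def)
  have 2: "residue (?h (- 1 - int 1 - int i)) v x \<in> zhu_O V g" for i x
    by (rule residue_mem_O'[OF T v, of 0 i]) (simp_all add: ex delta_def)
  have t: "t (Suc i) \<in> zhu_O V g" for i
    unfolding t_def by (intro O_closed 1 2)
  have "residue (?f (- 1)) u (residue (?h (- 1)) v w) - t 0 \<in> zhu_O V g"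
    using O_closed(3)[OF 2[of 0], of ?\<epsilon>] by (simp add: t_def)
  then have t0: "u \<star> (v \<star> w) - t 0 \<in> zhu_O V g"
    using u v by (simp add: star_eq_residue[of _ k] star_eq_residue[of _ l])
  have "\<forall>\<^sub>F N in sequentially. u \<star> v \<star> w - u \<star> (v \<star> w) \<in> zhu_O V g"
    using residue_star[OF u v star_hyps, of w] eventually_gt_at_top[of "0 :: nat"]
  proof eventually_elim
    case (elim N)
    then obtain M where M: "N = Suc M" by (cases N) auto
    have "u \<star> v \<star> w = (\<Sum>i<N. t i)"
      using elim u unfolding t_def by (simp add: star_eq_residue[of u k])
    then have "u \<star> v \<star> w - u \<star> (v \<star> w) = (\<Sum>i<M. t (Suc i)) - (u \<star> (v \<star> w) - t 0)"
      unfolding M sum.lessThan_Suc_shift by simp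
    also have "\<dots> \<in> zhu_O V g"
      by (intro O_closed(2) t0 subspace_sum[OF subspace_O] t)
    finally show ?case .
  qed
  then show ?thesis by simp
qed

text \<open>For \<open>r > 0\<close> the circle product has a simple pole, so its value with the
  vacuum as second argument is \<open>v\<close> itself. Only \<open>E 0\<close> survives in the
  quotient.\<close>

lemma eigenspace_subset_O:
  assumes "v \<in> vgrade V k \<inter> E r" "0 < r" "r < T"
  shows "v \<in> zhu_O V g"
  using residue_mem_O'[OF assms(3,1), of 0 0 _ _ "vvac V"] assms(2)
  by (simp add: delta_def residue_vac)

lemma subspace_hom_diff_O:
  assumes "module_hom (vscale V) (vscale V) h" "module_hom (vscale V) (vscale V) h'"
  shows "subspace {x. h x - h' x \<in> zhu_O V g}"
  proof (rule subspaceI)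
    fix x y c
    assume "x \<in> {x. h x - h' x \<in> zhu_O V g}"
    then have x: "h x - h' x \<in> zhu_O V g" by simp
    from O_closed(3)[OF this, of c] show "vscale V c x \<in> {x. h x - h' x \<in> zhu_O V g}"
      by (simp add: module_hom.scale[OF assms(1)] module_hom.scale[OF assms(2)] scale_right_diff_distrib)
    assume "y \<in> {x. h x - h' x \<in> zhu_O V g}"
    with O_closed(1)[OF x] have "h x - h' x + (h y - h' y) \<in> zhu_O V g" by simp
    then show "x + y \<in> {x. h x - h' x \<in> zhu_O V g}"
      by (simp add: module_hom.add[OF assms(1)] module_hom.add[OF assms(2)] add_diff_add)
  qed (simp add: module_hom.zero[OF assms(1)] module_hom.zero[OF assms(2)] O_closed)

lemma star_assoc: "u \<star> v \<star> w - u \<star> (v \<star> w) \<in> zhu_O V g"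
proof -
  have "u \<in> {u. u \<star> v \<star> w - u \<star> (v \<star> w) \<in> zhu_O V g}"
  proof (rule homogeneous_induct)
    show "subspace {u. u \<star> v \<star> w - u \<star> (v \<star> w) \<in> zhu_O V g}"
      by (rule subspace_hom_diff_O[OF module_hom_compose[OF module_hom_star(2) module_hom_star(2), unfolded o_def]
          module_hom_star(2)])
    fix k r u assume r: "r < T" and u: "u \<in> vgrade V k \<inter> E r"
    have "v \<in> {v. u \<star> v \<star> w - u \<star> (v \<star> w) \<in> zhu_O V g}"
    proof (rule homogeneous_induct)
      show "subspace {v. u \<star> v \<star> w - u \<star> (v \<star> w) \<in> zhu_O V g}"
        by (rule subspace_hom_diff_O[OF module_hom_compose[OF module_hom_star(1) module_hom_star(2), unfolded o_def]
            module_hom_compose[OF module_hom_star(2) module_hom_star(1), unfolded o_def]])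
      fix l s v assume s: "s < T" and v: "v \<in> vgrade V l \<inter> E s"
      \<comment> \<open>For \<open>0 < r\<close> both products with \<open>u\<close> on the left
        vanish. For \<open>r = 0 < s\<close>, \<open>v \<star> w\<close> is zero and the modes of
        \<open>u\<close> map \<open>v\<close> into an eigenspace on which \<open>\<star>\<close>
        vanishes.\<close>
      consider "0 < r" | "r = 0" "0 < s" | "r = 0" "s = 0" by auto
      then show "v \<in> {v. u \<star> v \<star> w - u \<star> (v \<star> w) \<in> zhu_O V g}"
      proof cases
        case 1
        then show ?thesis using r u by (simp add: star_eq_0[of u k r] O_closed)
      next
        case 2
        then have "u \<star> v \<star> w = 0"
          using s u v residue_star_eq_0[of u k 0 v l s] by (simp add: star_eq_residue[of u k])
        moreover have "v \<star> w = 0"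
          using 2 s v by (simp add: star_eq_0[of v l s])
        ultimately show ?thesis by (simp add: O_closed)
      next
        case 3
        then show ?thesis using star_assoc_homogeneous[of u k v l w] u v by simp
      qed
    qed
    then show "u \<in> {u. u \<star> v \<star> w - u \<star> (v \<star> w) \<in> zhu_O V g}" by simp
  qed
  then show ?thesis by simp
qed

section \<open>The unit and the central element\<close>

lemma vac_star: "vvac V \<star> v = v"
  by (simp add: star_eq_residue[OF vac_grade vac_eigenspace] weight_def residue_X_intpow vacuum)

text \<open>On \<open>E 0\<close> this is exact by creation; on the other eigenspaces the product is
  zero and the vector itself lies in \<open>zhu_O\<close>.\<close>

lemma star_vac: "v \<star> vvac V - v \<in> zhu_O V g"
proof -
  have "v \<in> {v. v \<star> vvac V - v \<in> zhu_O V g}"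
  proof (rule homogeneous_induct)
    show "subspace {v. v \<star> vvac V - v \<in> zhu_O V g}"
      by (rule subspace_hom_diff_O[OF module_hom_star(2)]) (simp add: module_hom_iff module_axioms)
    fix k r v assume r: "r < T" and v: "v \<in> vgrade V k \<inter> E r"
    show "v \<in> {v. v \<star> vvac V - v \<in> zhu_O V g}"
    proof (cases "r = 0")
      case True
      with v show ?thesis by (simp add: star_eq_residue[of v k] residue_vac O_closed)
    next
      case False
      with v r show ?thesis
        by (simp add: star_eq_0[of v k r] O_closed eigenspace_subset_O[of v k r])
    qed
  qed
  then show ?thesis by simp
qed

text \<open>The commutator of the mode \<open>- 1\<close> of \<open>\<omega>\<close> with
  \<open>v_f\<close>, applied to the vacuum, is that mode applied to \<open>v\<close> minus
  \<open>v \<star> \<omega>\<close>. Modulo \<open>zhu_O\<close> only its term \<open>t 0\<close>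
  remains, and with the other two terms of \<open>\<omega> \<star> v\<close> it gives a multiple of
  \<open>v\<close> circle the vacuum.\<close>

lemma conf_star_commute_homogeneous:
  assumes v: "v \<in> vgrade V k \<inter> E 0"
  shows "vconf V \<star> v - v \<star> vconf V \<in> zhu_O V g"
proof -
  let ?\<omega> = "vconf V" and ?b = "weight k" and ?L = "virL V (- 1) v"
  let ?f = "binomial_fls ?b (- 1)" and ?X = "binomial_fls 0 (- 1)"
  have T: "0 < T" by (rule twist_order_properties)
  have ex: "circ_exponent j 0 = weight j" for j
    by (simp add: circ_exponent_def delta_def)
  have vk: "v \<in> vgrade V k" using v by simp
  have O1: "?L + vscale V ?b v \<in> zhu_O V g"
    using residue_mem_O'[OF T v, of 0 0 ?b "- 2" "vvac V"] by (simp add: ex delta_def residue_vac_2)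
  have O2: "residue (binomial_fls ?b (- 3)) v (vvac V) \<in> zhu_O V g"
    by (rule residue_mem_O'[OF T v, of 0 1]) (simp_all add: ex delta_def)
  define t where "t i = residue (hasse_deriv i ?X * ?f) (vmode V ?\<omega> (int i) v) (vvac V)" for i
  have t_Suc: "t (Suc i) \<in> zhu_O V g" for i
  proof (cases "0 \<le> int 4 + int k - 2 * int (Suc i) - 2")
    case True
    let ?j = "nat (int 4 + int k - 2 * int (Suc i) - 2)"
    have x: "vmode V ?\<omega> (int (Suc i)) v \<in> vgrade V ?j \<inter> E 0"
      using mode_grade[OF conf_grade vk, of "int (Suc i)"]
        mode_eigenspace[of ?\<omega> 4 0 v k 0 "int (Suc i)"] conf_grade conf_eigenspace v by simp
    \<comment> \<open>The vector has weight \<open>?b - i\<close>, so \<open>i\<close> factors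
      \<open>1 + z\<close> exceed its own exponent; the \<open>i + 1\<close> additional poles
      suffice.\<close>
    have "?b = circ_exponent ?j 0 + of_nat i"
      unfolding ex weight_mode_nat[OF True] by (simp add: weight_def)
    then have "residue (binomial_fls ?b (- 2 - int (Suc i))) (vmode V ?\<omega> (int (Suc i)) v) (vvac V)
        \<in> zhu_O V g"
      by (rule residue_mem_O'[OF T x le_SucI[OF le_refl]]) (simp add: delta_def)
    from O_closed(3)[OF this] show ?thesis
      unfolding t_def hasse_deriv_X_intpow mult.assoc binomial_fls_mult residue_scale_series
      by simp
  qed (simp add: t_def mode_eq_0[OF conf_grade vk] O_closed)
  \<comment> \<open>The mode 0 of \<open>\<omega>\<close> is \<open>L(-1)\<close>, so partial
    integration moves the derivative to the series.\<close>
  have "t 0 = - residue (fls_deriv (binomial_fls ?b (- 2))) v (vvac V)"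
    by (simp add: t_def hasse_deriv_def binomial_fls_mult residue_translation[symmetric] virL_def)
  also have "\<dots> = vscale V 2 (residue (binomial_fls ?b (- 3)) v (vvac V)) -
      vscale V ?b (?L + vscale V (?b - 1) v)"
  proof -
    have "fls_deriv (binomial_fls ?b (- 2)) =
        fls_const ?b * binomial_fls (?b - 1) (- 2) + fls_const (- 2) * binomial_fls ?b (- 3)"
      using fls_deriv_binomial_fls[of ?b "- 2"] by simp
    then show ?thesis
      by (simp only: residue_add_series residue_scale_series residue_vac_2) simp
  qed
  finally have t_0: "t 0 + vscale V ?b (?L + vscale V (?b - 1) v) \<in> zhu_O V g"
    using O_closed(3)[OF O2] by simp
  have \<omega>v: "?\<omega> \<star> v = vmode V ?\<omega> (- 1) v + vscale V 2 ?L + vscale V ?b v"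
  proof -
    \<comment> \<open>Writing the weight 2 as \<open>0 + 1 + 1\<close> lets
      \<open>binomial_fls_add_one\<close> apply twice and leaves monomials.\<close>
    have "?\<omega> \<star> v = residue (binomial_fls (0 + 1 + 1) (- 1)) ?\<omega> v"
      by (simp add: star_eq_residue[OF conf_grade conf_eigenspace] weight_def)
    also have "\<dots> = vmode V ?\<omega> (- 1) v + vmode V ?\<omega> 0 v + (vmode V ?\<omega> 0 v + vmode V ?\<omega> 1 v)"
      unfolding binomial_fls_add_one residue_add_series residue_X_intpow by simp
    also have "vmode V ?\<omega> 1 v = vscale V ?b v"
      using L0_grade[OF vk] by (simp add: virL_def)
    also have "vmode V ?\<omega> 0 v = ?L"
      by (simp add: virL_def)
    finally show ?thesis
      by (simp add: scale_left_distrib[of 1 1, simplified] add_ac)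
  qed
  have "\<forall>\<^sub>F N in sequentially. ?\<omega> \<star> v - v \<star> ?\<omega> \<in> zhu_O V g"
    using commutator[OF conf_grade vk, of ?X ?f "vvac V"] eventually_gt_at_top[of "0 :: nat"]
  proof eventually_elim
    case (elim N)
    then obtain M where M: "N = Suc M" by (cases N) auto
    have "vmode V ?\<omega> (- 1) v - v \<star> ?\<omega> = t 0 + (\<Sum>i<M. t (Suc i))"
      using elim(1) v unfolding M t_def[symmetric] sum.lessThan_Suc_shift
      by (simp add: residue_vac residue_X_intpow creation power_mult star_eq_residue[of v k])
    then have "?\<omega> \<star> v - v \<star> ?\<omega> = t 0 + (\<Sum>i<M. t (Suc i)) + (vscale V 2 ?L + vscale V ?b v)"
      unfolding \<omega>v by (simp add: algebra_simps)
    \<comment> \<open>The multiples of \<open>L(-1) v\<close> and \<open>v\<close> not absorbed by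
      \<open>t 0\<close> have the coefficients \<open>2 - ?b\<close> and
      \<open>(2 - ?b) * ?b\<close>, hence combine to the element in \<open>O1\<close>.\<close>
    also have "\<dots> = (t 0 + vscale V ?b (?L + vscale V (?b - 1) v)) + (\<Sum>i<M. t (Suc i)) +
        vscale V (2 - ?b) (?L + vscale V ?b v)"
    proof -
      have "vscale V (?b * 2) v = vscale V ?b v + vscale V ?b v"
        by (simp only: mult_2_right scale_left_distrib)
      then show ?thesis by (simp add: algebra_simps)
    qed
    also have "\<dots> \<in> zhu_O V g"
      by (intro O_closed(1,3) t_0 subspace_sum[OF subspace_O] t_Suc O1)
    finally show ?case .
  qed
  then show ?thesis by simp
qed

lemma conf_star_commute: "vconf V \<star> v - v \<star> vconf V \<in> zhu_O V g"
proof -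
  have "v \<in> {v. vconf V \<star> v - v \<star> vconf V \<in> zhu_O V g}"
  proof (rule homogeneous_induct)
    show "subspace {v. vconf V \<star> v - v \<star> vconf V \<in> zhu_O V g}"
      by (rule subspace_hom_diff_O[OF module_hom_star])
    fix k r v assume r: "r < T" and v: "v \<in> vgrade V k \<inter> E r"
    show "v \<in> {v. vconf V \<star> v - v \<star> vconf V \<in> zhu_O V g}"
    proof (cases "r = 0")
      case True
      with v show ?thesis by (simp add: conf_star_commute_homogeneous[of v k])
    next
      case False
      with v r have "v \<in> zhu_O V g" "v \<star> vconf V = 0"
        by (auto intro: eigenspace_subset_O star_eq_0)
      then show ?thesis by (simp add: star_O)
    qed
  qed
  then show ?thesis by simp
qed

section \<open>The quotient algebra\<close>

abbreviation "cl \<equiv> zhu_class V g"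
abbreviation "A \<equiv> zhu_algebra V g"
abbreviation "\<C> \<equiv> (ring_of_type_algebra :: complex ring)"

lemma mem_class: "x \<in> cl v \<longleftrightarrow> x - v \<in> zhu_O V g"
proof
  assume "x - v \<in> zhu_O V g"
  then have "v + (x - v) \<in> cl v" unfolding zhu_class_def by (rule imageI)
  then show "x \<in> cl v" by simp
qed (auto simp: zhu_class_def)

lemma class_eqI:
  assumes "u - v \<in> zhu_O V g"
  shows "cl u = cl v"
proof (intro subset_antisym subsetI)
  fix x
  show "x \<in> cl v" if "x \<in> cl u"
    using O_closed(1)[OF that[unfolded mem_class] assms] by (simp add: mem_class)
  show "x \<in> cl u" if "x \<in> cl v"
    using O_closed(2)[OF that[unfolded mem_class] assms] by (simp add: mem_class)
qed

lemma class_refl: "v \<in> cl v"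
  by (simp add: mem_class O_closed)

text \<open>The operations on cosets are unions over representatives; such a union is a single coset
  once all results are congruent.\<close>

lemma UN_class:
  assumes "\<And>x. x \<in> cl a \<Longrightarrow> F x - F a \<in> zhu_O V g"
  shows "(\<Union>x\<in>cl a. cl (F x)) = cl (F a)"
  using class_eqI[OF assms] class_refl[of a] by blast

lemma UN_class2:
  assumes "\<And>x y. x \<in> cl a \<Longrightarrow> y \<in> cl b \<Longrightarrow> F x y - F a b \<in> zhu_O V g"
  shows "(\<Union>x\<in>cl a. \<Union>y\<in>cl b. cl (F x y)) = cl (F a b)"
  using class_eqI[OF assms] class_refl[of a] class_refl[of b] by blast

lemma carrier_A: "carrier A = range cl"
  by (simp add: zhu_algebra_def)

lemma zero_A: "\<zero>\<^bsub>A\<^esub> = cl 0"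
  by (simp add: zhu_algebra_def)

text \<open>Changing one factor at a time gives \<open>x \<star> y - u \<star> v = (x - u) \<star> y
  + u \<star> (y - v)\<close>, and \<open>zhu_O\<close> is a two-sided ideal.\<close>

lemma mult_A: "cl u \<otimes>\<^bsub>A\<^esub> cl v = cl (u \<star> v)"
proof -
  have "x \<star> y - u \<star> v \<in> zhu_O V g" if "x \<in> cl u" "y \<in> cl v" for x y
  proof -
    have "(x - u) \<star> y + u \<star> (y - v) \<in> zhu_O V g"
      by (intro O_closed(1) O_star star_O that[unfolded mem_class])
    then show ?thesis by (simp add: star_diff)
  qed
  from UN_class2[where F = "(\<star>)", OF this] show ?thesis
    by (simp add: zhu_algebra_def)
qed

lemma add_A: "cl u \<oplus>\<^bsub>A\<^esub> cl v = cl (u + v)"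
proof -
  have "x + y - (u + v) \<in> zhu_O V g" if "x \<in> cl u" "y \<in> cl v" for x y
    using O_closed(1)[OF that[unfolded mem_class]] by (simp add: algebra_simps)
  from UN_class2[where F = "(+)", OF this] show ?thesis
    by (simp add: zhu_algebra_def)
qed

lemma smult_A: "c \<odot>\<^bsub>A\<^esub> cl u = cl (vscale V c u)"
proof -
  have "vscale V c x - vscale V c u \<in> zhu_O V g" if "x \<in> cl u" for x
    using O_closed(3)[OF that[unfolded mem_class], of c] by (simp add: scale_right_diff_distrib)
  from UN_class[where F = "vscale V c", OF this] show ?thesis
    by (simp add: zhu_algebra_def)
qed

lemmas A_simps = carrier_A zero_A mult_A add_A smult_A

lemma ring_of_complex_simps:
  "carrier \<C> = UNIV" "a \<oplus>\<^bsub>\<C>\<^esub> b = a + b" "a \<otimes>\<^bsub>\<C>\<^esub> b = a * b" "\<one>\<^bsub>\<C>\<^esub> = 1"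
  by (simp_all add: ring_of_type_algebra_def)

lemma associative_algebra_A: "associative_algebra \<C> A"
proof (rule associative_algebra.intro)
  show "Module.module \<C> A"
  proof (rule Module.moduleI)
    show "abelian_group A"
    proof (rule abelian_groupI)
      fix x assume "x \<in> carrier A"
      then obtain a where a: "x = cl a" by (auto simp: A_simps)
      have "cl (- a) \<in> carrier A" "cl (- a) \<oplus>\<^bsub>A\<^esub> x = \<zero>\<^bsub>A\<^esub>"
        by (simp_all add: A_simps a)
      then show "\<exists>y\<in>carrier A. y \<oplus>\<^bsub>A\<^esub> x = \<zero>\<^bsub>A\<^esub>" by blast
    qed (auto simp: A_simps add_ac)
  qed (auto simp: A_simps ring_of_complex_simps cring_from_type_algebra
      scale_left_distrib scale_right_distrib)
  show "associative_algebra_axioms \<C> A"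
    by unfold_locales
      (auto simp: A_simps ring_of_complex_simps star_add star_scale class_eqI[OF star_assoc])
qed

lemma algebra_unit_A: "algebra_unit A (cl (vvac V))"
  by (auto simp: algebra_unit_def A_simps vac_star class_eqI[OF star_vac])

lemma conf_center_A: "cl (vconf V) \<in> algebra_center A"
  by (auto simp: algebra_center_def A_simps class_eqI[OF conf_star_commute])

end

theorem theorem3p3:
  fixes V :: "('v::ab_group_add) vosa" and g :: "'v \<Rightarrow> 'v"
  assumes "vertex_operator_superalgebra V"
    and "vosa_automorphism V g"
    and "has_finite_order g"
  shows "(\<forall>u v. zhu_class V g u \<otimes>\<^bsub>zhu_algebra V g\<^esub> zhu_class V g v =
             zhu_class V g (zhu_star V g u v)) \<and>
         associative_algebra (ring_of_type_algebra :: complex ring) (zhu_algebra V g) \<and>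
         algebra_unit (zhu_algebra V g) (zhu_class V g (vvac V)) \<and>
         zhu_class V g (vconf V) \<in> algebra_center (zhu_algebra V g)"
proof -
  interpret vosa_finite_automorphism V g
    by (intro vosa_finite_automorphism.intro vosa_finite_automorphism_axioms.intro assms)
  show ?thesis
    by (intro conjI allI mult_A associative_algebra_A algebra_unit_A conf_center_A)
qed

end
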